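(* For every $\rho\in[1,\infty]$, the map $\varrho_{\mathbb{K}}^{*}:L^{\rho}(\mathcal{O}_{\mathbb{K}})\to L^{\rho}([0,1])$, $(\varrho_{\mathbb{K}}^{*}f)(x)=f(\varrho_{\mathbb{K}}(x))$, is an isometric isomorphism of normed spaces, i.e., a linear surjective isometry.
   Context: Let $p$ be a prime and let $\mathbb{K}$ be $\mathbb{Q}_p$ (with $\wp=p$) or $\mathbb{F}_p((T))$ (with $\wp=T$), with ring of integers $\mathcal{O}_{\mathbb{K}}$ and Haar measure normalized by $\int_{\mathcal{O}_{\mathbb{K}}}dx=1$. $L^\rho(\mathcal{O}_{\mathbb{K}})$ is the real-valued $L^\rho$ space for this Haar measure, and $L^\rho([0,1])$ is the real-valued $L^\rho$ space for Lebesgue measure. Each $x\in[0,1)$ has a unique base-$p$ expansion $x=\sum_{i\ge0}x_ip^{-i-1}$, $x_i\in\{0,\dots,p-1\}$, produced by the greedy algorithm ($x_0=i$ if $i/p\le x<(i+1)/p$, and recursively $x_{N+1}=i$ if $i/p^{N+2}\le x-\sum_{j\le N}x_jp^{-j-1}<(i+1)/p^{N+2}$), so that finite expansions are used whenever possible. For $x=1$ all digits are $p-1$. Define $\varrho_{\mathbb{K}}:[0,1]\to\mathcal{O}_{\mathbb{K}}$ by $\varrho_{\mathbb{K}}\big(\sum_i x_ip^{-i-1}\big)=\sum_i x_i\wp^i$. *)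

theory Defs
  imports
    "HOL-Probability.Essential_Supremum"
    "HOL-Computational_Algebra.Formal_Laurent_Series"
    "Berlekamp_Zassenhaus.Finite_Field"
begin

section \<open>The p-adic absolute value on the rationals\<close>

definition padic_abs :: "nat \<Rightarrow> rat \<Rightarrow> real" where
  "padic_abs p r = (if r = 0 then 0 else
     real p powi (int (multiplicity (int p) (snd (quotient_of r)))
                  - int (multiplicity (int p) (fst (quotient_of r)))))"

context
  fixes p :: nat
  assumes p: "prime p"
begin

lemma p_int: "prime_elem (int p)"
  using p by simp

lemma padic_abs_0 [simp]: "padic_abs p 0 = 0"
  by (simp add: padic_abs_def)

lemma padic_abs_nonneg [simp]: "0 \<le> padic_abs p r"
  by (simp add: padic_abs_def)

lemma padic_abs_eq_0_iff [simp]: "padic_abs p r = 0 \<longleftrightarrow> r = 0"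
  using p by (auto simp: padic_abs_def power_int_eq_0_iff)

lemma padic_abs_frac:
  assumes "a \<noteq> 0" "b \<noteq> 0"
  shows "padic_abs p (of_int a / of_int b)
    = real p powi (int (multiplicity (int p) b) - int (multiplicity (int p) a))"
proof -
  let ?r = "of_int a / of_int b :: rat"
  obtain c d where q: "quotient_of ?r = (c, d)" by (cases "quotient_of ?r")
  have r: "?r = of_int c / of_int d" using q by (rule quotient_of_div)
  have d: "d > 0" using q by (rule quotient_of_denom_pos)
  have "?r \<noteq> 0" using assms by simp
  hence c: "c \<noteq> 0" using r by auto
  have "(of_int (a * d) :: rat) = of_int (c * b)"
    using r d assms by (simp add: field_simps)
  hence ad: "a * d = c * b" by (simp only: of_int_eq_iff)
  have "multiplicity (int p) (a * d) = multiplicity (int p) a + multiplicity (int p) d"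
    "multiplicity (int p) (c * b) = multiplicity (int p) c + multiplicity (int p) b"
    using assms c d by (auto intro!: prime_elem_multiplicity_mult_distrib[OF p_int])
  hence "int (multiplicity (int p) d) - int (multiplicity (int p) c)
      = int (multiplicity (int p) b) - int (multiplicity (int p) a)"
    using ad by simp
  thus ?thesis using \<open>?r \<noteq> 0\<close> by (simp add: padic_abs_def q)
qed

lemma rat_fracE:
  fixes r :: rat
  assumes "r \<noteq> 0"
  obtains a b where "a \<noteq> 0" "b \<noteq> 0" "r = of_int a / of_int b"
proof (rule that[of "fst (quotient_of r)" "snd (quotient_of r)"])
  have r: "r = of_int (fst (quotient_of r)) / of_int (snd (quotient_of r))"
    by (rule quotient_of_div) simp
  thus "r = of_int (fst (quotient_of r)) / of_int (snd (quotient_of r))" .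
  show "fst (quotient_of r) \<noteq> 0" using r assms by fastforce
  show "snd (quotient_of r) \<noteq> 0" using quotient_of_denom_pos'[of r] by simp
qed

lemma padic_abs_mult: "padic_abs p (r * s) = padic_abs p r * padic_abs p s"
proof (cases "r = 0 \<or> s = 0")
  case False
  then obtain a b c d where
    r: "a \<noteq> 0" "b \<noteq> 0" "r = of_int a / of_int b" and
    s: "c \<noteq> 0" "d \<noteq> 0" "s = of_int c / of_int d"
    by (metis rat_fracE)
  have "r * s = of_int (a * c) / of_int (b * d)" using r s by simp
  hence "padic_abs p (r * s)
    = real p powi (int (multiplicity (int p) (b * d)) - int (multiplicity (int p) (a * c)))"
    using padic_abs_frac[of "a * c" "b * d"] r s by simp
  also have "\<dots> = real p powi ((int (multiplicity (int p) b) - int (multiplicity (int p) a))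
      + (int (multiplicity (int p) d) - int (multiplicity (int p) c)))"
    using r s by (simp add: prime_elem_multiplicity_mult_distrib[OF p_int] algebra_simps)
  also have "\<dots> = padic_abs p r * padic_abs p s"
    using r s p by (simp add: padic_abs_frac power_int_add)
  finally show ?thesis .
qed auto

lemma padic_abs_1 [simp]: "padic_abs p 1 = 1"
  using padic_abs_frac[of 1 1] by simp

lemma padic_abs_minus [simp]: "padic_abs p (- r) = padic_abs p r"
proof -
  have "padic_abs p (-1) * padic_abs p (-1) = 1"
    by (simp flip: padic_abs_mult)
  moreover have "padic_abs p (-1) \<ge> 0" by simp
  ultimately have "padic_abs p (-1) = 1"
    by (metis abs_of_nonneg abs_1 power2_eq_iff_nonneg power2_eq_square mult_1 zero_le_one)
  thus ?thesis using padic_abs_mult[of "-1" r] by simp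
qed

lemma padic_abs_inverse: "padic_abs p (inverse r) = inverse (padic_abs p r)"
proof (cases "r = 0")
  case False
  hence "padic_abs p r * padic_abs p (inverse r) = 1"
    by (simp flip: padic_abs_mult)
  thus ?thesis using inverse_unique by metis
qed simp

lemma padic_abs_ultra: "padic_abs p (r + s) \<le> max (padic_abs p r) (padic_abs p s)"
proof (cases "r = 0 \<or> s = 0 \<or> r + s = 0")
  case True
  thus ?thesis by (auto simp: le_max_iff_disj)
next
  case False
  then obtain a b c d where
    r: "a \<noteq> 0" "b \<noteq> 0" "r = of_int a / of_int b" and
    s: "c \<noteq> 0" "d \<noteq> 0" "s = of_int c / of_int d"
    by (metis rat_fracE)
  let ?v = "multiplicity (int p)"
  have bd: "b * d \<noteq> 0" using r s by simp
  have r': "r = of_int (a * d) / of_int (b * d)" and s': "s = of_int (c * b) / of_int (b * d)"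
    using r s by simp_all
  have rs: "r + s = of_int (a * d + c * b) / of_int (b * d)"
    unfolding r' s' by (simp only: of_int_add add_divide_distrib)
  have nz: "a * d + c * b \<noteq> 0"
  proof
    assume "a * d + c * b = 0"
    hence "r + s = 0" by (simp only: rs of_int_0 div_0)
    thus False using False by simp
  qed
  have "int p ^ min (?v (a * d)) (?v (c * b)) dvd a * d + c * b"
    by (intro dvd_add multiplicity_dvd') auto
  hence le: "min (?v (a * d)) (?v (c * b)) \<le> ?v (a * d + c * b)"
    using nz p_int by (intro multiplicity_geI) (auto simp: prime_elem_def)
  have p1: "real p \<ge> 1" using p prime_gt_0_nat[of p] by simp
  have "padic_abs p (r + s) = real p powi (int (?v (b * d)) - int (?v (a * d + c * b)))"
    unfolding rs using nz bd by (rule padic_abs_frac)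
  moreover have "padic_abs p r = real p powi (int (?v (b * d)) - int (?v (a * d)))"
    unfolding r' using r s by (intro padic_abs_frac) auto
  moreover have "padic_abs p s = real p powi (int (?v (b * d)) - int (?v (c * b)))"
    unfolding s' using r s by (intro padic_abs_frac) auto
  ultimately show ?thesis
    using le p1 by (auto simp: min_def le_max_iff_disj split: if_splits intro!: power_int_increasing)
qed

lemma padic_abs_triangle: "padic_abs p (r + s) \<le> padic_abs p r + padic_abs p s"
  using padic_abs_ultra[of r s] padic_abs_nonneg[of r] padic_abs_nonneg[of s] by linarith

lemma padic_abs_diff_commute: "padic_abs p (r - s) = padic_abs p (s - r)"
  using padic_abs_minus[of "r - s"] by simp

lemma padic_abs_triangle3: "\<bar>padic_abs p r - padic_abs p s\<bar> \<le> padic_abs p (r - s)"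
  using padic_abs_triangle[of "r - s" s] padic_abs_triangle[of "s - r" r]
  by (simp add: padic_abs_diff_commute[of s r])

end


section \<open>The field of p-adic numbers\<close>

definition padic_cauchy :: "nat \<Rightarrow> (nat \<Rightarrow> rat) \<Rightarrow> bool" where
  "padic_cauchy p X \<longleftrightarrow> (\<forall>e>0. \<exists>k. \<forall>m\<ge>k. \<forall>n\<ge>k. padic_abs p (X m - X n) < e)"

definition padic_null :: "nat \<Rightarrow> (nat \<Rightarrow> rat) \<Rightarrow> bool" where
  "padic_null p X \<longleftrightarrow> (\<lambda>n. padic_abs p (X n)) \<longlonglongrightarrow> 0"

definition padic_rel :: "nat \<Rightarrow> (nat \<Rightarrow> rat) \<Rightarrow> (nat \<Rightarrow> rat) \<Rightarrow> bool" where
  "padic_rel p X Y \<longleftrightarrow> padic_cauchy p X \<and> padic_cauchy p Y \<and> padic_null p (\<lambda>n. X n - Y n)"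

context
  fixes p :: nat
  assumes p: "prime p"
begin

lemma padic_null_bound:
  assumes "f \<longlonglongrightarrow> 0" "eventually (\<lambda>n. padic_abs p (X n) \<le> f n) sequentially"
  shows "padic_null p X"
  unfolding padic_null_def
  by (rule tendsto_sandwich[OF _ assms(2) tendsto_const assms(1)])
     (simp add: padic_abs_nonneg[OF p])

lemma padic_null_0: "padic_null p (\<lambda>n. 0)"
  by (simp add: padic_null_def padic_abs_0[OF p])

lemma padic_null_minus: "padic_null p X \<Longrightarrow> padic_null p (\<lambda>n. - X n)"
  by (simp add: padic_null_def padic_abs_minus[OF p])

lemma padic_null_add:
  assumes "padic_null p X" "padic_null p Y"
  shows "padic_null p (\<lambda>n. X n + Y n)"
proof (rule padic_null_bound)
  show "(\<lambda>n. padic_abs p (X n) + padic_abs p (Y n)) \<longlonglongrightarrow> 0"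
    using assms unfolding padic_null_def by (intro tendsto_add_zero)
qed (simp add: padic_abs_triangle[OF p])

lemma padic_null_diff:
  assumes "padic_null p X" "padic_null p Y"
  shows "padic_null p (\<lambda>n. X n - Y n)"
  using padic_null_add[OF assms(1) padic_null_minus[OF assms(2)]] by simp

lemma padic_cauchy_const: "padic_cauchy p (\<lambda>n. r)"
  by (simp add: padic_cauchy_def padic_abs_0[OF p])

lemma padic_cauchy_add:
  assumes "padic_cauchy p X" "padic_cauchy p Y"
  shows "padic_cauchy p (\<lambda>n. X n + Y n)"
  unfolding padic_cauchy_def
proof (intro allI impI)
  fix e :: real assume e: "e > 0"
  obtain k where k: "\<forall>m\<ge>k. \<forall>n\<ge>k. padic_abs p (X m - X n) < e"
    using assms(1) e unfolding padic_cauchy_def by blast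
  obtain l where l: "\<forall>m\<ge>l. \<forall>n\<ge>l. padic_abs p (Y m - Y n) < e"
    using assms(2) e unfolding padic_cauchy_def by blast
  have "padic_abs p (X m + Y m - (X n + Y n)) < e" if "m \<ge> max k l" "n \<ge> max k l" for m n
  proof -
    have "padic_abs p (X m + Y m - (X n + Y n)) = padic_abs p ((X m - X n) + (Y m - Y n))"
      by (simp add: algebra_simps)
    also have "\<dots> \<le> max (padic_abs p (X m - X n)) (padic_abs p (Y m - Y n))"
      by (rule padic_abs_ultra[OF p])
    also have "\<dots> < e" using k l that by simp
    finally show ?thesis .
  qed
  thus "\<exists>k. \<forall>m\<ge>k. \<forall>n\<ge>k. padic_abs p (X m + Y m - (X n + Y n)) < e" by blast
qed

lemma padic_cauchy_minus:
  assumes "padic_cauchy p X"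
  shows "padic_cauchy p (\<lambda>n. - X n)"
proof -
  have "padic_abs p (- X m - - X n) = padic_abs p (X m - X n)" for m n
    using padic_abs_minus[OF p, of "X m - X n"] by simp
  thus ?thesis using assms by (simp only: padic_cauchy_def)
qed

lemma padic_cauchy_abs_convergent:
  assumes "padic_cauchy p X"
  shows "convergent (\<lambda>n. padic_abs p (X n))"
proof -
  have "Cauchy (\<lambda>n. padic_abs p (X n))"
  proof (rule metric_CauchyI)
    fix e :: real assume "e > 0"
    then obtain k where "\<forall>m\<ge>k. \<forall>n\<ge>k. padic_abs p (X m - X n) < e"
      using assms unfolding padic_cauchy_def by blast
    thus "\<exists>M. \<forall>m\<ge>M. \<forall>n\<ge>M. dist (padic_abs p (X m)) (padic_abs p (X n)) < e"
      using padic_abs_triangle3[OF p] unfolding dist_real_def by (meson le_less_trans)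
  qed
  thus ?thesis by (simp add: Cauchy_convergent_iff)
qed

lemma padic_cauchy_bounded:
  assumes "padic_cauchy p X"
  obtains B where "B > 0" "\<And>n. padic_abs p (X n) < B"
proof -
  have "Bseq (\<lambda>n. padic_abs p (X n))"
    using padic_cauchy_abs_convergent[OF assms] by (rule convergent_imp_Bseq)
  then obtain B where B: "B > 0" "\<And>n. norm (padic_abs p (X n)) \<le> B"
    by (rule BseqE) blast
  show ?thesis
  proof (rule that[of "B + 1"])
    fix n show "padic_abs p (X n) < B + 1"
      using B(2)[of n] by simp
  qed (use B in simp)
qed

lemma padic_cauchy_mult:
  assumes "padic_cauchy p X" "padic_cauchy p Y"
  shows "padic_cauchy p (\<lambda>n. X n * Y n)"
  unfolding padic_cauchy_def
proof (intro allI impI)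
  fix e :: real assume e: "e > 0"
  obtain A where A: "A > 0" "\<And>n. padic_abs p (X n) < A"
    using padic_cauchy_bounded[OF assms(1)] by blast
  obtain B where B: "B > 0" "\<And>n. padic_abs p (Y n) < B"
    using padic_cauchy_bounded[OF assms(2)] by blast
  obtain k where k: "\<forall>m\<ge>k. \<forall>n\<ge>k. padic_abs p (X m - X n) < e / B"
    using assms(1) e B unfolding padic_cauchy_def by (meson divide_pos_pos)
  obtain l where l: "\<forall>m\<ge>l. \<forall>n\<ge>l. padic_abs p (Y m - Y n) < e / A"
    using assms(2) e A unfolding padic_cauchy_def by (meson divide_pos_pos)
  have "padic_abs p (X m * Y m - X n * Y n) < e" if mn: "m \<ge> max k l" "n \<ge> max k l" for m n
  proof -
    have "padic_abs p (X m * Y m - X n * Y n)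
        = padic_abs p (X m * (Y m - Y n) + (X m - X n) * Y n)"
      by (simp add: algebra_simps)
    also have "\<dots> \<le> max (padic_abs p (X m) * padic_abs p (Y m - Y n))
                       (padic_abs p (X m - X n) * padic_abs p (Y n))"
      using padic_abs_ultra[OF p] by (simp flip: padic_abs_mult[OF p])
    also have "\<dots> < e"
    proof -
      have "padic_abs p (X m) * padic_abs p (Y m - Y n) < A * (e / A)"
        using A l mn by (intro mult_strict_mono') (auto simp: padic_abs_nonneg[OF p])
      moreover have "padic_abs p (X m - X n) * padic_abs p (Y n) < (e / B) * B"
        using B k mn by (intro mult_strict_mono') (auto simp: padic_abs_nonneg[OF p])
      ultimately show ?thesis using A B by simp
    qed
    finally show ?thesis .
  qed
  thus "\<exists>k. \<forall>m\<ge>k. \<forall>n\<ge>k. padic_abs p (X m * Y m - X n * Y n) < e" by blast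
qed

lemma padic_null_mult:
  assumes "padic_cauchy p X" "padic_null p Y"
  shows "padic_null p (\<lambda>n. X n * Y n)"
proof -
  obtain A where A: "A > 0" "\<And>n. padic_abs p (X n) < A"
    using padic_cauchy_bounded[OF assms(1)] by blast
  show ?thesis
  proof (rule padic_null_bound)
    show "(\<lambda>n. A * padic_abs p (Y n)) \<longlonglongrightarrow> 0"
      using assms(2) unfolding padic_null_def by (rule tendsto_mult_right_zero)
    show "eventually (\<lambda>n. padic_abs p (X n * Y n) \<le> A * padic_abs p (Y n)) sequentially"
      using A by (intro always_eventually allI)
        (simp add: padic_abs_mult[OF p] mult_right_mono less_imp_le padic_abs_nonneg[OF p])
  qed
qed

lemma padic_cauchy_not_null:
  assumes "padic_cauchy p X" "\<not> padic_null p X"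
  obtains b k where "b > 0" "\<And>n. n \<ge> k \<Longrightarrow> padic_abs p (X n) > b"
proof -
  obtain L where L: "(\<lambda>n. padic_abs p (X n)) \<longlonglongrightarrow> L"
    using padic_cauchy_abs_convergent[OF assms(1)] by (auto simp: convergent_def)
  have "L \<ge> 0"
    using L by (rule LIMSEQ_le_const) (simp add: padic_abs_nonneg[OF p])
  moreover have "L \<noteq> 0" using L assms(2) by (auto simp: padic_null_def)
  ultimately have L0: "L > 0" by simp
  hence "eventually (\<lambda>n. padic_abs p (X n) > L / 2) sequentially"
    using L by (intro order_tendstoD(1)[OF L]) simp
  then obtain k where "\<And>n. n \<ge> k \<Longrightarrow> padic_abs p (X n) > L / 2"
    by (auto simp: eventually_sequentially)
  thus ?thesis using that[of "L / 2" k] L0 by simp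
qed

lemma padic_abs_inverse_diff:
  assumes "x \<noteq> 0" "y \<noteq> 0"
  shows "padic_abs p (inverse x - inverse y)
    = inverse (padic_abs p x) * padic_abs p (x - y) * inverse (padic_abs p y)"
proof -
  have "inverse x - inverse y = - (inverse x * (x - y) * inverse y)"
    using assms by (rule inverse_diff_inverse)
  thus ?thesis
    by (simp add: padic_abs_minus[OF p] padic_abs_mult[OF p] padic_abs_inverse[OF p])
qed

lemma padic_cauchy_inverse:
  assumes X: "padic_cauchy p X" "\<not> padic_null p X"
  shows "padic_cauchy p (\<lambda>n. inverse (X n))"
  unfolding padic_cauchy_def
proof (intro allI impI)
  fix e :: real assume e: "e > 0"
  obtain b k where b: "b > 0" "\<And>n. n \<ge> k \<Longrightarrow> padic_abs p (X n) > b"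
    using padic_cauchy_not_null[OF X] by blast
  have "e * b * b > 0" using e b by simp
  then obtain l where l: "\<forall>m\<ge>l. \<forall>n\<ge>l. padic_abs p (X m - X n) < e * b * b"
    using X(1) unfolding padic_cauchy_def by blast
  have "padic_abs p (inverse (X m) - inverse (X n)) < e"
    if mn: "m \<ge> max k l" "n \<ge> max k l" for m n
  proof -
    have b': "padic_abs p (X m) > b" "padic_abs p (X n) > b" using b mn by auto
    hence nz: "X m \<noteq> 0" "X n \<noteq> 0" using b(1) by (auto simp: padic_abs_0[OF p])
    have "padic_abs p (inverse (X m) - inverse (X n))
        = padic_abs p (X m - X n) / (padic_abs p (X m) * padic_abs p (X n))"
      using padic_abs_inverse_diff[OF nz] by (simp add: field_simps)
    also have "\<dots> \<le> padic_abs p (X m - X n) / (b * b)"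
      using b' b(1) by (intro divide_left_mono mult_mono mult_pos_pos)
        (auto simp: padic_abs_nonneg[OF p])
    also have "\<dots> < e" using l mn b(1) by (simp add: field_simps)
    finally show ?thesis .
  qed
  thus "\<exists>k. \<forall>m\<ge>k. \<forall>n\<ge>k. padic_abs p (inverse (X m) - inverse (X n)) < e" by blast
qed

lemma padic_null_inverse_diff:
  assumes X: "padic_cauchy p X" "\<not> padic_null p X"
    and Y: "padic_cauchy p Y" "\<not> padic_null p Y"
    and XY: "padic_null p (\<lambda>n. X n - Y n)"
  shows "padic_null p (\<lambda>n. inverse (X n) - inverse (Y n))"
proof -
  obtain a k where a: "a > 0" "\<And>n. n \<ge> k \<Longrightarrow> padic_abs p (X n) > a"
    using padic_cauchy_not_null[OF X] by blast
  obtain b l where b: "b > 0" "\<And>n. n \<ge> l \<Longrightarrow> padic_abs p (Y n) > b"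
    using padic_cauchy_not_null[OF Y] by blast
  show ?thesis
  proof (rule padic_null_bound)
    show "(\<lambda>n. padic_abs p (X n - Y n) / (a * b)) \<longlonglongrightarrow> 0"
      using XY unfolding padic_null_def by (rule tendsto_divide_zero)
    have "padic_abs p (inverse (X n) - inverse (Y n)) \<le> padic_abs p (X n - Y n) / (a * b)"
      if "n \<ge> max k l" for n
    proof -
      have ab: "padic_abs p (X n) > a" "padic_abs p (Y n) > b" using a b that by auto
      hence nz: "X n \<noteq> 0" "Y n \<noteq> 0" using a(1) b(1) by (auto simp: padic_abs_0[OF p])
      have "padic_abs p (inverse (X n) - inverse (Y n))
          = padic_abs p (X n - Y n) / (padic_abs p (X n) * padic_abs p (Y n))"
        using padic_abs_inverse_diff[OF nz] by (simp add: field_simps)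
      also have "\<dots> \<le> padic_abs p (X n - Y n) / (a * b)"
        using ab a(1) b(1) by (intro divide_left_mono mult_mono mult_pos_pos)
          (auto simp: padic_abs_nonneg[OF p])
      finally show ?thesis .
    qed
    thus "eventually (\<lambda>n. padic_abs p (inverse (X n) - inverse (Y n))
        \<le> padic_abs p (X n - Y n) / (a * b)) sequentially"
      unfolding eventually_sequentially by blast
  qed
qed

lemma padic_rel_refl: "padic_cauchy p X \<Longrightarrow> padic_rel p X X"
  by (simp add: padic_rel_def padic_null_0)

lemma part_equivp_padic_rel: "part_equivp (padic_rel p)"
proof (rule part_equivpI)
  show "\<exists>X. padic_rel p X X"
    using padic_rel_refl padic_cauchy_const by blast
  show "symp (padic_rel p)"
    by (auto simp: symp_def padic_rel_def dest: padic_null_minus)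
  show "transp (padic_rel p)"
    by (rule transpI) (force simp: padic_rel_def dest: padic_null_add)
qed

lemma padic_rel_null_iff:
  assumes "padic_rel p X Y"
  shows "padic_null p X \<longleftrightarrow> padic_null p Y"
proof
  assume "padic_null p X"
  from padic_null_diff[OF this, of "\<lambda>n. X n - Y n"] show "padic_null p Y"
    using assms by (simp add: padic_rel_def)
next
  assume "padic_null p Y"
  from padic_null_add[OF this, of "\<lambda>n. X n - Y n"] show "padic_null p X"
    using assms by (simp add: padic_rel_def)
qed

lemma padic_rel_mult:
  assumes "padic_rel p X X'" "padic_rel p Y Y'"
  shows "padic_rel p (\<lambda>n. X n * Y n) (\<lambda>n. X' n * Y' n)"
proof -
  have "padic_null p (\<lambda>n. X n * (Y n - Y' n) + Y' n * (X n - X' n))"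
    using assms by (intro padic_null_add padic_null_mult) (auto simp: padic_rel_def)
  moreover have "(\<lambda>n. X n * (Y n - Y' n) + Y' n * (X n - X' n)) = (\<lambda>n. X n * Y n - X' n * Y' n)"
    by (simp add: algebra_simps)
  ultimately show ?thesis
    using assms by (simp add: padic_rel_def padic_cauchy_mult)
qed

lemma padic_rel_abs_lim:
  assumes "padic_rel p X Y"
  shows "lim (\<lambda>n. padic_abs p (X n)) = lim (\<lambda>n. padic_abs p (Y n))"
proof -
  have "(\<lambda>n. padic_abs p (Y n)) \<longlonglongrightarrow> lim (\<lambda>n. padic_abs p (Y n))"
    using assms padic_cauchy_abs_convergent unfolding padic_rel_def convergent_LIMSEQ_iff by blast
  moreover have "(\<lambda>n. padic_abs p (X n) - padic_abs p (Y n)) \<longlonglongrightarrow> 0"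
  proof (rule Lim_null_comparison)
    show "(\<lambda>n. padic_abs p (X n - Y n)) \<longlonglongrightarrow> 0"
      using assms by (simp add: padic_rel_def padic_null_def)
    show "eventually (\<lambda>n. norm (padic_abs p (X n) - padic_abs p (Y n))
        \<le> padic_abs p (X n - Y n)) sequentially"
      by (simp add: padic_abs_triangle3[OF p])
  qed
  ultimately have "(\<lambda>n. padic_abs p (X n)) \<longlonglongrightarrow> lim (\<lambda>n. padic_abs p (Y n))"
    using tendsto_add by fastforce
  thus ?thesis by (rule limI)
qed

end

text \<open>
  The completion of the rationals for the p-adic absolute value; the prime is the
  cardinality of the type parameter, as for \<^type>\<open>mod_ring\<close>. The quotient is
  set up by hand because \<open>quotient_type\<close> fails for a partial relation that depends on a
  type variable not occurring in the raw type.
\<close>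

typedef (overloaded) 'p padic =
  "{X. padic_cauchy CARD('p::prime_card) X} // {(X, Y). padic_rel CARD('p) X Y}"
  morphisms class_of_padic padic_of_class
  using padic_cauchy_const[OF prime_card] by (blast intro: quotientI)

definition abs_padic :: "(nat \<Rightarrow> rat) \<Rightarrow> 'p::prime_card padic" where
  "abs_padic X = padic_of_class ({(X, Y). padic_rel CARD('p) X Y} `` {X})"

definition rep_padic :: "'p::prime_card padic \<Rightarrow> nat \<Rightarrow> rat" where
  "rep_padic x = (SOME X. padic_cauchy CARD('p) X \<and> x = abs_padic X)"

definition cr_padic :: "(nat \<Rightarrow> rat) \<Rightarrow> 'p::prime_card padic \<Rightarrow> bool" where
  "cr_padic X x \<longleftrightarrow> padic_rel CARD('p) X X \<and> abs_padic X = x"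

lemma padic_rel_refl_iff: "padic_rel CARD('p::prime_card) X X \<longleftrightarrow> padic_cauchy CARD('p) X"
  using padic_rel_refl[OF prime_card] by (auto simp: padic_rel_def)

lemma abs_padic_eq_iff:
  assumes "padic_cauchy CARD('p) X" "padic_cauchy CARD('p) Y"
  shows "(abs_padic X :: 'p::prime_card padic) = abs_padic Y \<longleftrightarrow> padic_rel CARD('p) X Y"
proof -
  let ?R = "{(X, Y). padic_rel CARD('p) X Y}"
  have "equiv {X. padic_cauchy CARD('p) X} ?R"
  proof (rule equivI)
    show "refl_on {X. padic_cauchy CARD('p) X} ?R"
      by (rule refl_onI) (simp add: padic_rel_refl_iff)
    show "sym ?R"
      using part_equivp_symp[OF part_equivp_padic_rel[OF prime_card[where 'a='p]]]
      by (intro symI) simp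
    show "trans ?R"
      using part_equivp_transp[OF part_equivp_padic_rel[OF prime_card[where 'a='p]]]
      unfolding trans_def mem_Collect_eq prod.case by blast
    show "?R \<subseteq> {X. padic_cauchy CARD('p) X} \<times> {X. padic_cauchy CARD('p) X}"
      by (auto simp: padic_rel_def)
  qed
  hence "?R `` {X} = ?R `` {Y} \<longleftrightarrow> (X, Y) \<in> ?R"
    by (rule eq_equiv_class_iff) (use assms in simp_all)
  moreover have "?R `` {X} \<in> {X. padic_cauchy CARD('p) X} // ?R"
    "?R `` {Y} \<in> {X. padic_cauchy CARD('p) X} // ?R"
    using assms by (simp_all only: quotientI mem_Collect_eq)
  ultimately show ?thesis by (simp add: abs_padic_def padic_of_class_inject)
qed

lemma rep_padic: "padic_cauchy CARD('p) (rep_padic x) \<and> x = abs_padic (rep_padic x)"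
  for x :: "'p::prime_card padic"
proof -
  obtain X where "padic_cauchy CARD('p) X" "x = abs_padic X"
    using padic_of_class_cases[of x] by (metis abs_padic_def mem_Collect_eq quotientE)
  thus ?thesis unfolding rep_padic_def by (metis (mono_tags, lifting) someI_ex)
qed

lemma Quotient_padic:
  "Quotient (padic_rel CARD('p)) abs_padic rep_padic (cr_padic :: _ \<Rightarrow> 'p::prime_card padic \<Rightarrow> bool)"
proof (rule QuotientI)
  fix x :: "'p padic"
  show "abs_padic (rep_padic x) = x" "padic_rel CARD('p) (rep_padic x) (rep_padic x)"
    using rep_padic[of x] by (simp_all add: padic_rel_refl_iff)
next
  fix X Y
  show "padic_rel CARD('p) X Y \<longleftrightarrow> padic_rel CARD('p) X X \<and> padic_rel CARD('p) Y Y \<and>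
      (abs_padic X :: 'p padic) = abs_padic Y"
    using abs_padic_eq_iff[where 'p='p, of X Y] padic_rel_refl_iff[where 'p='p]
    by (metis padic_rel_def)
next
  show "(cr_padic :: _ \<Rightarrow> 'p padic \<Rightarrow> bool) = (\<lambda>X x. padic_rel CARD('p) X X \<and> abs_padic X = x)"
    by (simp add: fun_eq_iff cr_padic_def)
qed

setup_lifting Quotient_padic

instantiation padic :: (prime_card) field
begin

lift_definition zero_padic :: "'a padic" is "\<lambda>n. 0"
  by (simp add: padic_rel_refl padic_cauchy_const prime_card)

lift_definition one_padic :: "'a padic" is "\<lambda>n. 1"
  by (simp add: padic_rel_refl padic_cauchy_const prime_card)

lift_definition plus_padic :: "'a padic \<Rightarrow> 'a padic \<Rightarrow> 'a padic" is "\<lambda>X Y n. X n + Y n"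
  unfolding padic_rel_def add_diff_add
  by (simp add: padic_cauchy_add padic_null_add prime_card)

lift_definition uminus_padic :: "'a padic \<Rightarrow> 'a padic" is "\<lambda>X n. - X n"
  unfolding padic_rel_def minus_diff_minus
  by (simp only: padic_cauchy_minus padic_null_minus prime_card simp_thms)

lift_definition times_padic :: "'a padic \<Rightarrow> 'a padic \<Rightarrow> 'a padic" is "\<lambda>X Y n. X n * Y n"
  by (rule padic_rel_mult[OF prime_card])

lift_definition inverse_padic :: "'a padic \<Rightarrow> 'a padic"
  is "\<lambda>X. if padic_null CARD('a) X then (\<lambda>n. 0) else (\<lambda>n. inverse (X n))"
proof -
  fix X Y :: "nat \<Rightarrow> rat"
  assume XY: "padic_rel CARD('a) X Y"
  show "padic_rel CARD('a) (if padic_null CARD('a) X then (\<lambda>n. 0) else (\<lambda>n. inverse (X n)))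
      (if padic_null CARD('a) Y then (\<lambda>n. 0) else (\<lambda>n. inverse (Y n)))"
    using XY padic_rel_null_iff[OF prime_card XY]
    by (auto simp: padic_rel_def padic_cauchy_const[OF prime_card] padic_null_0[OF prime_card]
        intro!: padic_cauchy_inverse[OF prime_card] padic_null_inverse_diff[OF prime_card])
qed

definition minus_padic :: "'a padic \<Rightarrow> 'a padic \<Rightarrow> 'a padic" where
  "minus_padic x y = x + - y"

definition divide_padic :: "'a padic \<Rightarrow> 'a padic \<Rightarrow> 'a padic" where
  "divide_padic x y = x * inverse y"

lemma padic_null_const: "padic_null CARD('a) (\<lambda>n. r) \<longleftrightarrow> r = 0"
  using prime_card[where 'a='a] by (simp add: padic_null_def LIMSEQ_const_iff padic_abs_eq_0_iff)

instance
proof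
  fix a b c :: "'a padic"
  note [simp] = padic_rel_def padic_null_0[OF prime_card] padic_cauchy_add[OF prime_card]
    padic_cauchy_mult[OF prime_card] padic_cauchy_minus[OF prime_card]
    padic_cauchy_const[OF prime_card]
  show "a + b = b + a" by transfer (simp add: ac_simps)
  show "(a + b) + c = a + (b + c)" by transfer (simp add: ac_simps)
  show "0 + a = a" by transfer simp
  show "- a + a = 0" by transfer simp
  show "a - b = a + - b" by (rule minus_padic_def)
  show "(a * b) * c = a * (b * c)" by transfer (simp add: ac_simps)
  show "a * b = b * a" by transfer (simp add: ac_simps)
  show "1 * a = a" by transfer simp
  show "(a + b) * c = a * c + b * c" by transfer (simp add: distrib_right)
  show "(0::'a padic) \<noteq> 1" by transfer (simp add: padic_null_const)
  show "inverse a * a = 1" if "a \<noteq> 0"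
    using that
  proof transfer
    fix X :: "nat \<Rightarrow> rat"
    assume "padic_rel CARD('a) X X" and nr: "\<not> padic_rel CARD('a) X (\<lambda>n. 0)"
    hence X: "padic_cauchy CARD('a) X" "\<not> padic_null CARD('a) X" by auto
    obtain b k where b: "b > 0" "\<And>n. n \<ge> k \<Longrightarrow> padic_abs CARD('a) (X n) > b"
      using padic_cauchy_not_null[OF prime_card X] by blast
    have "inverse (X n) * X n - 1 = 0" if "n \<ge> k" for n
      using b(1) b(2)[OF that] by (cases "X n = 0") (auto simp: padic_abs_0[OF prime_card])
    hence "eventually (\<lambda>n. padic_abs CARD('a) (inverse (X n) * X n - 1) \<le> 0) sequentially"
      unfolding eventually_sequentially
      by (intro exI[of _ k]) (simp add: padic_abs_0[OF prime_card])
    hence "padic_null CARD('a) (\<lambda>n. inverse (X n) * X n - 1)"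
      by (rule padic_null_bound[OF prime_card tendsto_const])
    thus "padic_rel CARD('a) (\<lambda>n. (if padic_null CARD('a) X then \<lambda>n. 0 else (\<lambda>n. inverse (X n))) n * X n) (\<lambda>n. 1)"
      using X by (simp add: padic_cauchy_inverse[OF prime_card])
  qed
  show "a div b = a * inverse b" by (rule divide_padic_def)
  show "inverse (0::'a padic) = 0" by transfer simp
qed

end

lift_definition padic_norm :: "'p::prime_card padic \<Rightarrow> real"
  is "\<lambda>X. lim (\<lambda>n. padic_abs CARD('p) (X n))"
  by (rule padic_rel_abs_lim[OF prime_card])

lemma padic_norm_eq_0_iff: "padic_norm x = 0 \<longleftrightarrow> x = (0::'p::prime_card padic)"
proof transfer
  fix X :: "nat \<Rightarrow> rat"
  assume "padic_rel CARD('p) X X"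
  hence X: "padic_cauchy CARD('p) X" by (simp add: padic_rel_def)
  hence "(\<lambda>n. padic_abs CARD('p) (X n)) \<longlonglongrightarrow> lim (\<lambda>n. padic_abs CARD('p) (X n))"
    using padic_cauchy_abs_convergent[OF prime_card] by (simp add: convergent_LIMSEQ_iff)
  thus "lim (\<lambda>n. padic_abs CARD('p) (X n)) = 0 \<longleftrightarrow> padic_rel CARD('p) X (\<lambda>n. 0)"
    using X by (auto simp: padic_rel_def padic_null_def padic_cauchy_const[OF prime_card]
        intro: limI)
qed

lemma padic_norm_minus: "padic_norm (- x) = padic_norm (x::'p::prime_card padic)"
  by transfer (simp add: padic_abs_minus[OF prime_card])

lemma padic_norm_triangle:
  "padic_norm (x + y) \<le> padic_norm x + padic_norm (y::'p::prime_card padic)"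
proof transfer
  fix X Y :: "nat \<Rightarrow> rat"
  assume "padic_rel CARD('p) X X" "padic_rel CARD('p) Y Y"
  hence XY: "padic_cauchy CARD('p) X" "padic_cauchy CARD('p) Y"
    by (simp_all add: padic_rel_def)
  have lim: "(\<lambda>n. padic_abs CARD('p) (Z n)) \<longlonglongrightarrow> lim (\<lambda>n. padic_abs CARD('p) (Z n))"
    if "padic_cauchy CARD('p) Z" for Z
    using padic_cauchy_abs_convergent[OF prime_card that] by (simp add: convergent_LIMSEQ_iff)
  show "lim (\<lambda>n. padic_abs CARD('p) (X n + Y n))
      \<le> lim (\<lambda>n. padic_abs CARD('p) (X n)) + lim (\<lambda>n. padic_abs CARD('p) (Y n))"
    by (rule LIMSEQ_le[OF lim[OF padic_cauchy_add[OF prime_card XY]]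
          tendsto_add[OF lim[OF XY(1)] lim[OF XY(2)]]])
       (simp add: padic_abs_triangle[OF prime_card])
qed

instantiation padic :: (prime_card) metric_space
begin

definition dist_padic_def: "dist (x::'a padic) y = padic_norm (x - y)"

definition uniformity_padic_def [code del]:
  "(uniformity :: ('a padic \<times> 'a padic) filter) = (INF e\<in>{0<..}. principal {(x, y). dist x y < e})"

definition open_padic_def [code del]:
  "open (U :: 'a padic set) \<longleftrightarrow> (\<forall>x\<in>U. eventually (\<lambda>(x', y). x' = x \<longrightarrow> y \<in> U) uniformity)"

instance
proof
  fix x y z :: "'a padic"
  show "dist x y = 0 \<longleftrightarrow> x = y"
    by (simp add: dist_padic_def padic_norm_eq_0_iff)
  show "dist x y \<le> dist x z + dist y z"
    using padic_norm_triangle[of "x - z" "z - y"] padic_norm_minus[of "y - z"]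
    by (simp add: dist_padic_def)
qed (rule open_padic_def uniformity_padic_def)+

end


section \<open>Ring of integers and Haar measure\<close>

text \<open>
  Both fields carry an absolute value \<open>dist x 0\<close>. For Laurent series the library normalizes
  it by \<open>dist fls_X 0 = 1/2\<close>, which affects neither the topology nor the unit ball.
\<close>

definition ring_of_integers :: "'k::{metric_space, zero} set" (\<open>\<O>\<close>) where
  "\<O> = {x. dist x 0 \<le> 1}"

text \<open>
  Radon regularity is not required separately: it is automatic for Borel measures finite on
  compact sets, as both fields are locally compact and second countable.
\<close>

definition haar_measure :: "'k::{topological_space, ab_group_add} measure \<Rightarrow> bool" where
  "haar_measure \<mu> \<longleftrightarrow>
     sets \<mu> = sets borel \<and>
     emeasure \<mu> UNIV \<noteq> 0 \<and>
     (\<forall>C. compact C \<longrightarrow> emeasure \<mu> C < \<infinity>) \<and>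
     (\<forall>a. \<forall>A\<in>sets \<mu>. emeasure \<mu> ((+) a ` A) = emeasure \<mu> A)"

definition normalized_haar_measure :: "'k::{metric_space, ab_group_add} measure \<Rightarrow> bool" where
  "normalized_haar_measure \<mu> \<longleftrightarrow> haar_measure \<mu> \<and> emeasure \<mu> \<O> = 1"


section \<open>Real-valued Lebesgue spaces\<close>

text \<open>
  Elements of \<open>L\<^sup>\<rho>(M)\<close> are classes of almost everywhere equal functions. The functions
  are total, but their values outside \<open>space M\<close> are irrelevant to \<open>ae_rel M\<close>. The
  operations on classes are unions over all representatives, as usual for quotients.
\<close>

definition Lp_functions :: "ennreal \<Rightarrow> 'a measure \<Rightarrow> ('a \<Rightarrow> real) set" where
  "Lp_functions \<rho> M = {f \<in> borel_measurable M.
     if \<rho> = \<infinity> then esssup M (\<lambda>x. ereal \<bar>f x\<bar>) < \<infinity>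
     else integrable M (\<lambda>x. \<bar>f x\<bar> powr enn2real \<rho>)}"

definition Lp_seminorm :: "ennreal \<Rightarrow> 'a measure \<Rightarrow> ('a \<Rightarrow> real) \<Rightarrow> real" where
  "Lp_seminorm \<rho> M f =
     (if \<rho> = \<infinity> then real_of_ereal (esssup M (\<lambda>x. ereal \<bar>f x\<bar>))
      else (LINT x|M. \<bar>f x\<bar> powr enn2real \<rho>) powr (1 / enn2real \<rho>))"

definition ae_rel :: "'a measure \<Rightarrow> (('a \<Rightarrow> real) \<times> ('a \<Rightarrow> real)) set" where
  "ae_rel M = {(f, g). f \<in> borel_measurable M \<and> g \<in> borel_measurable M \<and> (AE x in M. f x = g x)}"

definition Lp :: "ennreal \<Rightarrow> 'a measure \<Rightarrow> ('a \<Rightarrow> real) set set" where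
  "Lp \<rho> M = Lp_functions \<rho> M // ae_rel M"

definition Lp_add :: "'a measure \<Rightarrow> ('a \<Rightarrow> real) set \<Rightarrow> ('a \<Rightarrow> real) set \<Rightarrow> ('a \<Rightarrow> real) set" where
  "Lp_add M F G = (\<Union>f\<in>F. \<Union>g\<in>G. ae_rel M `` {\<lambda>x. f x + g x})"

definition Lp_scale :: "'a measure \<Rightarrow> real \<Rightarrow> ('a \<Rightarrow> real) set \<Rightarrow> ('a \<Rightarrow> real) set" where
  "Lp_scale M c F = (\<Union>f\<in>F. ae_rel M `` {\<lambda>x. c * f x})"

definition Lp_norm :: "ennreal \<Rightarrow> 'a measure \<Rightarrow> ('a \<Rightarrow> real) set \<Rightarrow> real" where
  "Lp_norm \<rho> M F = the_elem (Lp_seminorm \<rho> M ` F)"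

definition linear_surjective_isometry ::
    "ennreal \<Rightarrow> 'a measure \<Rightarrow> 'b measure \<Rightarrow> (('a \<Rightarrow> real) set \<Rightarrow> ('b \<Rightarrow> real) set) \<Rightarrow> bool" where
  "linear_surjective_isometry \<rho> M N T \<longleftrightarrow>
     (\<forall>F\<in>Lp \<rho> M. \<forall>G\<in>Lp \<rho> M. T (Lp_add M F G) = Lp_add N (T F) (T G)) \<and>
     (\<forall>c. \<forall>F\<in>Lp \<rho> M. T (Lp_scale M c F) = Lp_scale N c (T F)) \<and>
     (\<forall>F\<in>Lp \<rho> M. Lp_norm \<rho> N (T F) = Lp_norm \<rho> M F) \<and>
     T ` Lp \<rho> M = Lp \<rho> N"

definition pullback ::
    "'b measure \<Rightarrow> ('b \<Rightarrow> 'a) \<Rightarrow> ('a \<Rightarrow> real) set \<Rightarrow> ('b \<Rightarrow> real) set" where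
  "pullback N \<phi> F = (\<Union>f\<in>F. ae_rel N `` {\<lambda>x. f (\<phi> x)})"

definition pullback_well_defined ::
    "ennreal \<Rightarrow> 'a measure \<Rightarrow> 'b measure \<Rightarrow> ('b \<Rightarrow> 'a) \<Rightarrow> bool" where
  "pullback_well_defined \<rho> M N \<phi> \<longleftrightarrow>
     \<phi> \<in> space N \<rightarrow> space M \<and>
     (\<forall>f\<in>Lp_functions \<rho> M.
        (\<lambda>x. f (\<phi> x)) \<in> Lp_functions \<rho> N \<and>
        pullback N \<phi> (ae_rel M `` {f}) = ae_rel N `` {\<lambda>x. f (\<phi> x)})"


section \<open>Base-p digits and the digit map\<close>

fun greedy_digit :: "nat \<Rightarrow> real \<Rightarrow> nat \<Rightarrow> nat" where
  "greedy_digit p x N = (THE i.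
     real i / real p ^ Suc N \<le> x - (\<Sum>j<N. real (greedy_digit p x j) / real p ^ Suc j) \<and>
     x - (\<Sum>j<N. real (greedy_digit p x j) / real p ^ Suc j) < (real i + 1) / real p ^ Suc N)"

declare greedy_digit.simps [simp del]

definition digit :: "nat \<Rightarrow> real \<Rightarrow> nat \<Rightarrow> nat" where
  "digit p x i = (if x = 1 then p - 1 else greedy_digit p x i)"

text \<open>Only the values on \<open>{0..1}\<close> are meaningful.\<close>

definition varrho :: "nat \<Rightarrow> 'k::{field, metric_space} \<Rightarrow> real \<Rightarrow> 'k" where
  "varrho p \<pi> x = (\<Sum>i. of_nat (digit p x i) * \<pi> ^ i)"

end

theory Submission
  imports Defs
begin

text \<open>
  The greedy digits of \<open>x < 1\<close> are \<open>\<lfloor>p\<^sup>N\<^sup>+\<^sup>1 x\<rfloor> mod p\<close>, so the digit map sends the interval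
  \<open>[k/p\<^sup>N, (k+1)/p\<^sup>N)\<close> into a coset of \<open>\<pi>\<^sup>N\<O>\<close>, and the \<open>p\<^sup>N\<close> cosets obtained in this way partition
  \<open>\<O>\<close>. By translation invariance each coset has Haar measure \<open>p\<^sup>-\<^sup>N\<close>, the length of the interval.
  As the cosets are stable under intersection and generate the Borel sets of \<open>\<O>\<close>, the digit map is
  measure preserving, hence its pullback is isometric. It is onto because the digit map has
  a Borel left inverse off the point \<open>1\<close> and every Lebesgue measurable function agrees almost everywhere
  with a Borel one.
\<close>

section \<open>Pullback along a measure-preserving map\<close>

lemma ae_rel_equiv: "equiv (borel_measurable M) (ae_rel M)"
proof (rule equivI)
  show "ae_rel M \<subseteq> borel_measurable M \<times> borel_measurable M"
    by (auto simp: ae_rel_def)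
  show "refl_on (borel_measurable M) (ae_rel M)"
    by (auto simp: refl_on_def ae_rel_def)
  show "sym (ae_rel M)"
    by (rule symI) (simp add: ae_rel_def eq_commute)
  show "trans (ae_rel M)"
  proof (rule transI)
    fix f g h assume "(f, g) \<in> ae_rel M" "(g, h) \<in> ae_rel M"
    then have "f \<in> borel_measurable M" "h \<in> borel_measurable M"
      and "AE x in M. f x = g x" "AE x in M. g x = h x"
      by (simp_all add: ae_rel_def)
    then show "(f, h) \<in> ae_rel M"
      unfolding ae_rel_def by auto
  qed
qed

lemma ae_class_eq_iff:
  "f \<in> borel_measurable M \<Longrightarrow> g \<in> borel_measurable M \<Longrightarrow>
    ae_rel M `` {f} = ae_rel M `` {g} \<longleftrightarrow> (AE x in M. f x = g x)"
  using eq_equiv_class_iff[OF ae_rel_equiv[of M]] by (simp add: ae_rel_def)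

lemma mem_ae_class_iff:
  "f \<in> borel_measurable M \<Longrightarrow>
    g \<in> ae_rel M `` {f} \<longleftrightarrow> g \<in> borel_measurable M \<and> (AE x in M. f x = g x)"
  by (simp add: ae_rel_def)

text \<open>The union over all representatives collapses: every pair of representatives yields the
  same class, and the classes are nonempty, so the union is that class.\<close>

lemma Lp_add_class:
  assumes [measurable]: "f \<in> borel_measurable M" "g \<in> borel_measurable M"
  shows "Lp_add M (ae_rel M `` {f}) (ae_rel M `` {g}) = ae_rel M `` {\<lambda>x. f x + g x}"
proof -
  have "ae_rel M `` {\<lambda>x. f' x + g' x} = ae_rel M `` {\<lambda>x. f x + g x}"
    if "f' \<in> ae_rel M `` {f}" "g' \<in> ae_rel M `` {g}" for f' g'
  proof -
    from that have [measurable]: "f' \<in> borel_measurable M" "g' \<in> borel_measurable M"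
      and "AE x in M. f x = f' x" "AE x in M. g x = g' x"
      by (auto simp: ae_rel_def)
    then have "AE x in M. f' x + g' x = f x + g x"
      by auto
    then show ?thesis
      by (subst ae_class_eq_iff) auto
  qed
  moreover have "f \<in> ae_rel M `` {f}" "g \<in> ae_rel M `` {g}"
    by (auto simp: ae_rel_def)
  ultimately show ?thesis
    unfolding Lp_add_def by (intro UN_constant_eq ballI)
qed

lemma Lp_scale_class:
  assumes [measurable]: "f \<in> borel_measurable M"
  shows "Lp_scale M c (ae_rel M `` {f}) = ae_rel M `` {\<lambda>x. c * f x}"
proof -
  have "ae_rel M `` {\<lambda>x. c * f' x} = ae_rel M `` {\<lambda>x. c * f x}"
    if "f' \<in> ae_rel M `` {f}" for f'
  proof -
    from that have [measurable]: "f' \<in> borel_measurable M" and ae: "AE x in M. f x = f' x"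
      by (auto simp: ae_rel_def)
    from ae have "AE x in M. c * f' x = c * f x"
      by eventually_elim simp
    then show ?thesis
      by (subst ae_class_eq_iff) auto
  qed
  moreover have "f \<in> ae_rel M `` {f}"
    by (auto simp: ae_rel_def)
  ultimately show ?thesis
    unfolding Lp_scale_def by (intro UN_constant_eq ballI)
qed

lemma
  assumes [measurable]: "f \<in> borel_measurable M" "g \<in> borel_measurable M"
    and ae: "AE x in M. f x = g x"
  shows Lp_functions_cong_AE: "f \<in> Lp_functions \<rho> M \<longleftrightarrow> g \<in> Lp_functions \<rho> M"
    and Lp_seminorm_cong_AE: "Lp_seminorm \<rho> M f = Lp_seminorm \<rho> M g"
proof -
  have "esssup M (\<lambda>x. ereal \<bar>f x\<bar>) = esssup M (\<lambda>x. ereal \<bar>g x\<bar>)"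
    using ae by (intro esssup_AE_cong) auto
  moreover have "integrable M (\<lambda>x. \<bar>f x\<bar> powr enn2real \<rho>) \<longleftrightarrow> integrable M (\<lambda>x. \<bar>g x\<bar> powr enn2real \<rho>)"
    using ae by (intro integrable_cong_AE) auto
  moreover have "(LINT x|M. \<bar>f x\<bar> powr enn2real \<rho>) = (LINT x|M. \<bar>g x\<bar> powr enn2real \<rho>)"
    using ae by (intro integral_cong_AE) auto
  ultimately show "f \<in> Lp_functions \<rho> M \<longleftrightarrow> g \<in> Lp_functions \<rho> M"
    "Lp_seminorm \<rho> M f = Lp_seminorm \<rho> M g"
    by (simp_all add: Lp_functions_def Lp_seminorm_def)
qed

text \<open>The seminorm is constant on a class, so its image is a singleton and
  \<open>the_elem\<close> in \<open>Lp_norm\<close> returns a meaningful value.\<close>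

lemma Lp_norm_class:
  assumes "f \<in> borel_measurable M"
  shows "Lp_norm \<rho> M (ae_rel M `` {f}) = Lp_seminorm \<rho> M f"
proof -
  have "Lp_seminorm \<rho> M g = Lp_seminorm \<rho> M f" if "g \<in> ae_rel M `` {f}" for g
    using that assms by (metis Lp_seminorm_cong_AE mem_ae_class_iff)
  moreover have "f \<in> ae_rel M `` {f}"
    using assms by (simp add: ae_rel_def)
  ultimately have "Lp_seminorm \<rho> M ` (ae_rel M `` {f}) = {Lp_seminorm \<rho> M f}"
    by (metis image_constant image_cong)
  then show ?thesis
    by (simp add: Lp_norm_def)
qed

lemma Lp_eq: "Lp \<rho> M = (\<lambda>f. ae_rel M `` {f}) ` Lp_functions \<rho> M"
  by (auto simp: Lp_def quotient_def)

lemma Lp_functions_measurable: "f \<in> Lp_functions \<rho> M \<Longrightarrow> f \<in> borel_measurable M"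
  by (simp add: Lp_functions_def)

section \<open>Composition with a measure-preserving map\<close>

context
  fixes M :: "'a measure" and N :: "'b measure" and \<phi>
  assumes meas [measurable]: "\<phi> \<in> N \<rightarrow>\<^sub>M M" and distr: "distr N M \<phi> = M"
begin

lemma AE_pullback:
  assumes [measurable]: "Measurable.pred M P"
  shows "(AE x in N. P (\<phi> x)) \<longleftrightarrow> (AE x in M. P x)"
proof -
  have "(AE x in N. P (\<phi> x)) \<longleftrightarrow> (AE x in distr N M \<phi>. P x)"
    by (rule AE_distr_iff[OF meas, symmetric]) measurable
  then show ?thesis
    by (simp only: distr)
qed

lemma pullback_class:
  assumes [measurable]: "f \<in> borel_measurable M"
  shows "pullback N \<phi> (ae_rel M `` {f}) = ae_rel N `` {\<lambda>x. f (\<phi> x)}"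
proof -
  have "ae_rel N `` {\<lambda>x. g (\<phi> x)} = ae_rel N `` {\<lambda>x. f (\<phi> x)}" if "g \<in> ae_rel M `` {f}" for g
  proof -
    from that have [measurable]: "g \<in> borel_measurable M" and "AE x in M. f x = g x"
      by (auto simp: ae_rel_def)
    then have "AE x in M. g x = f x"
      by auto
    then show ?thesis
      by (subst ae_class_eq_iff) (auto simp: AE_pullback[where P = "\<lambda>x. g x = f x"])
  qed
  moreover have "f \<in> ae_rel M `` {f}"
    by (auto simp: ae_rel_def)
  ultimately show ?thesis
    unfolding pullback_def by (intro UN_constant_eq ballI)
qed

text \<open>The essential supremum is the infimum of the almost everywhere upper bounds, and
  \<open>f\<close> and its pullback have the same such bounds.\<close>

lemma esssup_pullback:
  fixes f :: "'a \<Rightarrow> ereal"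
  assumes [measurable]: "f \<in> borel_measurable M"
  shows "esssup N (\<lambda>x. f (\<phi> x)) = esssup M f"
proof -
  have "(AE x in N. f (\<phi> x) \<le> z) \<longleftrightarrow> (AE x in M. f x \<le> z)" for z
    by (rule AE_pullback) measurable
  then show ?thesis
    by (simp add: esssup_eq_AE)
qed

lemma
  assumes [measurable]: "f \<in> borel_measurable M"
  shows Lp_functions_pullback: "(\<lambda>x. f (\<phi> x)) \<in> Lp_functions \<rho> N \<longleftrightarrow> f \<in> Lp_functions \<rho> M"
    and Lp_seminorm_pullback: "Lp_seminorm \<rho> N (\<lambda>x. f (\<phi> x)) = Lp_seminorm \<rho> M f"
proof -
  have "esssup N (\<lambda>x. ereal \<bar>f (\<phi> x)\<bar>) = esssup M (\<lambda>x. ereal \<bar>f x\<bar>)"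
    by (rule esssup_pullback) measurable
  moreover have "integrable N (\<lambda>x. \<bar>f (\<phi> x)\<bar> powr enn2real \<rho>) \<longleftrightarrow> integrable M (\<lambda>x. \<bar>f x\<bar> powr enn2real \<rho>)"
    using integrable_distr_eq[OF meas, of "\<lambda>x. \<bar>f x\<bar> powr enn2real \<rho>"] by (simp add: distr)
  moreover have "(LINT x|N. \<bar>f (\<phi> x)\<bar> powr enn2real \<rho>) = (LINT x|M. \<bar>f x\<bar> powr enn2real \<rho>)"
    using integral_distr[OF meas, of "\<lambda>x. \<bar>f x\<bar> powr enn2real \<rho>"] by (simp add: distr)
  ultimately show "(\<lambda>x. f (\<phi> x)) \<in> Lp_functions \<rho> N \<longleftrightarrow> f \<in> Lp_functions \<rho> M"
    "Lp_seminorm \<rho> N (\<lambda>x. f (\<phi> x)) = Lp_seminorm \<rho> M f"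
    by (simp_all add: Lp_functions_def Lp_seminorm_def)
qed

lemma pullback_well_definedI: "pullback_well_defined \<rho> M N \<phi>"
  unfolding pullback_well_defined_def
proof (intro conjI ballI funcsetI)
  show "\<phi> x \<in> space M" if "x \<in> space N" for x
    using that by (rule measurable_space[OF meas])
next
  fix f assume f: "f \<in> Lp_functions \<rho> M"
  then have "f \<in> borel_measurable M"
    by (rule Lp_functions_measurable)
  with f show "(\<lambda>x. f (\<phi> x)) \<in> Lp_functions \<rho> N"
    "pullback N \<phi> (ae_rel M `` {f}) = ae_rel N `` {\<lambda>x. f (\<phi> x)}"
    by (simp_all only: Lp_functions_pullback pullback_class)
qed

text \<open>Linearity and the isometry property follow from the computations on classes;
  \<open>ex\<close> supplies preimages for surjectivity. It asks only for a measurable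
  \<open>f\<close>, because integrability or essential boundedness of \<open>f\<close> can be read
  off its pullback.\<close>

lemma linear_surjective_isometry_pullback:
  assumes ex: "\<And>g. g \<in> borel_measurable N \<Longrightarrow> \<exists>f\<in>borel_measurable M. AE x in N. f (\<phi> x) = (g x :: real)"
  shows "linear_surjective_isometry \<rho> M N (pullback N \<phi>)"
  unfolding linear_surjective_isometry_def
proof (intro conjI ballI allI)
  fix F G assume "F \<in> Lp \<rho> M" "G \<in> Lp \<rho> M"
  then obtain f g where [simp]: "F = ae_rel M `` {f}" "G = ae_rel M `` {g}"
    and "f \<in> Lp_functions \<rho> M" "g \<in> Lp_functions \<rho> M"
    by (auto simp: Lp_eq)
  then have [measurable]: "f \<in> borel_measurable M" "g \<in> borel_measurable M"
    by (simp_all add: Lp_functions_measurable)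
  show "pullback N \<phi> (Lp_add M F G) = Lp_add N (pullback N \<phi> F) (pullback N \<phi> G)"
    by (simp add: Lp_add_class pullback_class)
next
  fix F c assume "F \<in> Lp \<rho> M"
  then obtain f where [simp]: "F = ae_rel M `` {f}" and "f \<in> Lp_functions \<rho> M"
    by (auto simp: Lp_eq)
  then have [measurable]: "f \<in> borel_measurable M"
    by (simp add: Lp_functions_measurable)
  show "pullback N \<phi> (Lp_scale M c F) = Lp_scale N c (pullback N \<phi> F)"
    by (simp add: Lp_scale_class pullback_class)
  show "Lp_norm \<rho> N (pullback N \<phi> F) = Lp_norm \<rho> M F"
    by (simp add: Lp_norm_class pullback_class Lp_seminorm_pullback)
next
  show "pullback N \<phi> ` Lp \<rho> M = Lp \<rho> N"
  proof (intro equalityI subsetI)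
    fix G assume "G \<in> pullback N \<phi> ` Lp \<rho> M"
    then show "G \<in> Lp \<rho> N"
      by (auto simp: Lp_eq pullback_class Lp_functions_pullback Lp_functions_measurable)
  next
    fix G assume "G \<in> Lp \<rho> N"
    then obtain g where G: "G = ae_rel N `` {g}" and g: "g \<in> Lp_functions \<rho> N"
      by (auto simp: Lp_eq)
    then have [measurable]: "g \<in> borel_measurable N"
      by (simp add: Lp_functions_measurable)
    obtain f where f [measurable]: "f \<in> borel_measurable M" and ae: "AE x in N. f (\<phi> x) = g x"
      using ex[of g] by auto
    \<comment> \<open>The pullback of \<open>f\<close> agrees almost everywhere with
      \<open>g\<close>, so it lies in the Lebesgue space over \<open>N\<close>; measure preservation
      carries this back to \<open>f\<close>.\<close>
    have "f \<in> Lp_functions \<rho> M"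
      using g ae Lp_functions_cong_AE[where M = N and f = "\<lambda>x. f (\<phi> x)" and g = g and \<rho> = \<rho>]
      by (simp add: Lp_functions_pullback)
    moreover have "pullback N \<phi> (ae_rel M `` {f}) = G"
      using ae by (simp add: G pullback_class ae_class_eq_iff)
    ultimately show "G \<in> pullback N \<phi> ` Lp \<rho> M"
      by (auto simp: Lp_eq)
  qed
qed

end

section \<open>Greedy digits\<close>

lemma nat_floor_mult_div:
  fixes x :: real
  assumes "x \<ge> 0" "p > 0"
  shows "nat \<lfloor>real p * x\<rfloor> div p = nat \<lfloor>x\<rfloor>"
proof -
  have "\<lfloor>real p * x\<rfloor> div int p = \<lfloor>x\<rfloor>"
    using floor_divide_real_eq_div[of "int p" "real p * x"] assms by simp
  then show ?thesis
    using assms by (metis nat_div_distrib' nat_int of_nat_0_le_iff)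
qed

text \<open>Dropping the last base-\<open>p\<close> digit of an integer approximation gives the
  previous approximation; this is the recursion behind the greedy digits and behind
  \<open>trunc\<close>.\<close>

lemma floor_power_div:
  fixes x :: real
  assumes "p > 0" "x \<ge> 0"
  shows "nat \<lfloor>real p ^ Suc N * x\<rfloor> div p = nat \<lfloor>real p ^ N * x\<rfloor>"
  using nat_floor_mult_div[of "real p ^ N * x" p] assms by (simp add: mult.assoc)

lemma floor_power_less:
  fixes x :: real
  assumes "p > 0" "0 \<le> x" "x < 1"
  shows "nat \<lfloor>real p ^ N * x\<rfloor> < p ^ N"
proof -
  have "real p ^ N * x < real p ^ N"
    using assms by simp
  then have "\<lfloor>real p ^ N * x\<rfloor> < int (p ^ N)"
    by (simp add: floor_less_iff)
  then show ?thesis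
    using assms by (simp add: nat_less_iff)
qed

context
  fixes p :: nat and x :: real
  assumes p: "p > 0" and x: "0 \<le> x" "x < 1"
begin

text \<open>The assumption is the closed form of the partial sums, whose inductive proof in turn
  uses this step. Separating the two avoids a simultaneous induction.\<close>

lemma greedy_digit_step:
  assumes "(\<Sum>j<N. real (greedy_digit p x j) / real p ^ Suc j) = real (nat \<lfloor>real p ^ N * x\<rfloor>) / real p ^ N"
  shows "greedy_digit p x N = nat \<lfloor>real p ^ Suc N * x\<rfloor> mod p"
proof -
  define k where "k n = nat \<lfloor>real p ^ n * x\<rfloor>" for n
  have k: "real (k n) \<le> real p ^ n * x" "real p ^ n * x < real (k n) + 1" for n
    using x p by (simp_all add: k_def)
  have "k (Suc N) div p = k N"
    using floor_power_div[OF p x(1)] by (simp add: k_def)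
  then have mod: "real (k (Suc N)) = real p * real (k N) + real (k (Suc N) mod p)"
    by (metis mult_div_mod_eq of_nat_add of_nat_mult)
  \<comment> \<open>Scaling by \<open>p ^ Suc N\<close> turns the greedy condition into a half-open
    unit interval for the remainder, which contains exactly one integer. This also makes the
    \<open>THE\<close> in \<open>greedy_digit\<close> well defined.\<close>
  have iff: "real i / real p ^ Suc N \<le> x - real (k N) / real p ^ N \<and>
      x - real (k N) / real p ^ N < (real i + 1) / real p ^ Suc N \<longleftrightarrow> i = k (Suc N) mod p" for i
  proof -
    define D where "D = real p ^ Suc N"
    have D: "D > 0"
      using p by (simp add: D_def)
    have "x - real (k N) / real p ^ N = (D * x - real p * real (k N)) / D"
      using p by (simp add: D_def field_simps)
    then have "real i / D \<le> x - real (k N) / real p ^ N \<and> x - real (k N) / real p ^ N < (real i + 1) / D \<longleftrightarrow>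
      real i \<le> D * x - real p * real (k N) \<and> D * x - real p * real (k N) < real i + 1"
      using D by (simp add: divide_le_cancel divide_less_cancel)
    also have "\<dots> \<longleftrightarrow> i = k (Suc N) mod p"
      using k[of "Suc N"] mod unfolding D_def by linarith
    finally show ?thesis
      by (simp only: D_def)
  qed
  show ?thesis
    unfolding greedy_digit.simps[of p x N] assms k_def[symmetric] iff by simp
qed

lemma greedy_digit_sum:
  "(\<Sum>j<N. real (greedy_digit p x j) / real p ^ Suc j) = real (nat \<lfloor>real p ^ N * x\<rfloor>) / real p ^ N"
proof (induction N)
  case 0
  then show ?case
    using x by (simp add: floor_eq_iff)
next
  case (Suc N)
  define k where "k n = nat \<lfloor>real p ^ n * x\<rfloor>" for n
  have "k (Suc N) div p = k N"
    using floor_power_div[OF p x(1)] by (simp add: k_def)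
  then have "real (k (Suc N)) = real p * real (k N) + real (k (Suc N) mod p)"
    by (metis mult_div_mod_eq of_nat_add of_nat_mult)
  then show ?case
    using p Suc greedy_digit_step[OF Suc] by (simp add: k_def field_simps)
qed

lemma greedy_digit_eq: "greedy_digit p x N = nat \<lfloor>real p ^ Suc N * x\<rfloor> mod p"
  by (rule greedy_digit_step[OF greedy_digit_sum])

end

section \<open>Digit expansions in a complete ultrametric field\<close>

text \<open>This collects what the two fields share, so that the argument is given once. Here
  \<open>r\<close> is the absolute value of the uniformizer \<pi>. The two residue assumptions say
  that 0, ..., p - 1 represent \<O> modulo \<pi> without repetition, and
  \<open>summable_digits\<close> is the instance of completeness that the digit map
  requires.\<close>

locale digit_expansion =
  fixes p :: nat and \<pi> :: "'k::{field, metric_space}" and r :: real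
  assumes p: "p \<ge> 2"
    and r: "0 < r" "r < 1"
    and dist_add: "dist (x + z) (y + z) = dist x (y :: 'k)"
    and dist_ultra: "dist x z \<le> max (dist x y) (dist y (z :: 'k))"
    and dist_mult: "dist (\<pi> * x) 0 = r * dist x 0"
    and dist_of_nat: "dist (of_nat n) (0 :: 'k) \<le> 1"
    and ex_residue: "dist x (0 :: 'k) \<le> 1 \<Longrightarrow> \<exists>d<p. dist x (of_nat d) \<le> r"
    and residue_unique: "d < p \<Longrightarrow> e < p \<Longrightarrow> dist (of_nat d) (of_nat e :: 'k) \<le> r \<Longrightarrow> d = e"
    and summable_digits: "(\<And>i. a i < p) \<Longrightarrow> summable (\<lambda>i. of_nat (a i) * \<pi> ^ i)"
begin

section \<open>Discs and truncated expansions\<close>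

lemma dist_diff: "dist (x - z) (y - z) = dist x (y :: 'k)"
  using dist_add[of "x - z" z "y - z"] by simp

lemma dist_diff_0: "dist (x - y) 0 = dist x (y :: 'k)"
  using dist_diff[of x y y] by simp

lemma dist_le_trans: "dist x y \<le> e \<Longrightarrow> dist y z \<le> e \<Longrightarrow> dist x (z :: 'k) \<le> e"
  using dist_ultra[of x z y] by simp

lemma pi_nonzero: "\<pi> \<noteq> 0"
proof
  assume "\<pi> = 0"
  then have "dist (0 :: 'k) 0 = r * dist (1 :: 'k) 0"
    using dist_mult[of 1] by simp
  then show False
    using r by simp
qed

lemma dist_power_mult: "dist (\<pi> ^ n * x) 0 = r ^ n * dist x 0"
  by (induction n) (simp_all add: mult.assoc dist_mult)

text \<open>The base-\<open>p\<close> digits of \<open>k\<close> are read from the most significant one.\<close>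

primrec trunc :: "nat \<Rightarrow> nat \<Rightarrow> 'k" where
  "trunc 0 k = 0"
| "trunc (Suc N) k = trunc N (k div p) + of_nat (k mod p) * \<pi> ^ N"

text \<open>This is the coset of \<pi>^N \<O> through \<open>trunc N k\<close>. The number
  \<open>k < p ^ N\<close> encodes the first \<open>N\<close> digits, so that the disc has the same
  index as the interval from k/p^N to (k+1)/p^N.\<close>

definition disc :: "nat \<Rightarrow> nat \<Rightarrow> 'k set" where
  "disc N k = {x. dist x (trunc N k) \<le> r ^ N}"

lemma dist_digit_le: "dist (x + of_nat d * \<pi> ^ N) x \<le> r ^ N"
proof -
  have "dist (x + of_nat d * \<pi> ^ N) x = r ^ N * dist (of_nat d :: 'k) 0"
    using dist_diff[of "x + of_nat d * \<pi> ^ N" x x] dist_power_mult[of N "of_nat d"]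
    by (simp add: mult.commute)
  also have "\<dots> \<le> r ^ N"
    using r dist_of_nat[of d] by (simp add: mult_left_le)
  finally show ?thesis .
qed

lemma power_r_mono: "m \<le> n \<Longrightarrow> r ^ n \<le> r ^ m"
  using r by (intro power_decreasing) auto

lemma trunc_integral: "trunc N k \<in> \<O>"
proof (induction N arbitrary: k)
  case 0
  then show ?case by (simp add: ring_of_integers_def)
next
  case (Suc N)
  have "dist (trunc (Suc N) k) (trunc N (k div p)) \<le> 1"
    using dist_digit_le[of "trunc N (k div p)" "k mod p" N] power_r_mono[of 0 N] by simp
  with Suc[of "k div p"] show ?case
    unfolding ring_of_integers_def mem_Collect_eq by (rule dist_le_trans[rotated])
qed

lemma disc_0: "disc 0 k = \<O>"
  by (simp add: disc_def ring_of_integers_def)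

lemma disc_subset: "disc N k \<subseteq> \<O>"
proof
  fix x assume "x \<in> disc N k"
  then have "dist x (trunc N k) \<le> 1"
    using power_r_mono[of 0 N] by (simp add: disc_def)
  then show "x \<in> \<O>"
    using trunc_integral[of N k] unfolding ring_of_integers_def mem_Collect_eq
    by (rule dist_le_trans)
qed

text \<open>The digits are found one at a time: the error after \<open>N\<close> digits, rescaled to
  an integral element, has a residue, and this residue is the next digit.\<close>

lemma ex_disc:
  assumes "x \<in> \<O>"
  shows "\<exists>k<p ^ N. x \<in> disc N k"
proof (induction N)
  case 0
  then show ?case using assms by (simp add: disc_0)
next
  case (Suc N)
  then obtain k where k: "k < p ^ N" "dist x (trunc N k) \<le> r ^ N"
    by (auto simp: disc_def)
  \<comment> \<open>The error is divisible by \<pi>^N; its quotient \<open>y\<close> is integral,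
    and its residue \<open>d\<close> is appended to \<open>k\<close> as the new last digit, giving
    \<open>k * p + d\<close>.\<close>
  define y where "y = (x - trunc N k) / \<pi> ^ N"
  have x: "x = trunc N k + \<pi> ^ N * y"
    using pi_nonzero by (simp add: y_def)
  then have "r ^ N * dist y 0 \<le> r ^ N"
    using k dist_diff_0[of x "trunc N k"] dist_power_mult[of N y] by simp
  then have "dist y 0 \<le> 1"
    using r by simp
  then obtain d where d: "d < p" "dist y (of_nat d) \<le> r"
    using ex_residue by blast
  have "x - trunc (Suc N) (k * p + d) = \<pi> ^ N * (y - of_nat d)"
    using d by (simp add: x algebra_simps)
  then have "dist x (trunc (Suc N) (k * p + d)) = r ^ N * dist y (of_nat d)"
    by (metis dist_diff_0 dist_power_mult)
  also have "\<dots> \<le> r ^ Suc N"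
    using d r by simp
  finally have "x \<in> disc (Suc N) (k * p + d)"
    by (simp only: disc_def mem_Collect_eq)
  moreover have "k * p + d < p ^ Suc N"
  proof -
    have "k * p + d < (k + 1) * p"
      using d by simp
    also have "\<dots> \<le> p ^ N * p"
      using k by (intro mult_right_mono) auto
    finally show ?thesis by (simp add: mult.commute)
  qed
  ultimately show ?case by blast
qed

text \<open>Closeness at level N + 1 implies closeness at level N after the last digits are dropped,
  so the leading digits agree by induction. Cancelling \<pi>^N then leaves a congruence between the
  last digits, which are distinct residues unless equal.\<close>

lemma trunc_unique:
  assumes "k < p ^ N" "l < p ^ N" "dist (trunc N k) (trunc N l) \<le> r ^ N"
  shows "k = l"
  using assms
proof (induction N arbitrary: k l)
  case 0
  then show ?case by simp
next
  case (Suc N)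
  have "dist (trunc N (k div p)) (trunc (Suc N) k) \<le> r ^ N"
    "dist (trunc (Suc N) l) (trunc N (l div p)) \<le> r ^ N"
    using dist_digit_le[of "trunc N (k div p)" "k mod p" N]
      dist_digit_le[of "trunc N (l div p)" "l mod p" N] by (simp_all add: dist_commute)
  moreover have "dist (trunc (Suc N) k) (trunc (Suc N) l) \<le> r ^ N"
    using Suc.prems(3) power_r_mono[of N "Suc N"] by simp
  ultimately have "dist (trunc N (k div p)) (trunc N (l div p)) \<le> r ^ N"
    by (meson dist_le_trans)
  moreover have "k div p < p ^ N" "l div p < p ^ N"
    using Suc.prems p by (simp_all add: less_mult_imp_div_less mult.commute)
  ultimately have div: "k div p = l div p"
    using Suc.IH by blast
  have "trunc (Suc N) k - trunc (Suc N) l = \<pi> ^ N * (of_nat (k mod p) - of_nat (l mod p))"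
    by (simp add: div algebra_simps)
  then have "dist (trunc (Suc N) k) (trunc (Suc N) l) = r ^ N * dist (of_nat (k mod p) :: 'k) (of_nat (l mod p))"
    by (metis dist_diff_0 dist_power_mult)
  then have "r ^ N * dist (of_nat (k mod p) :: 'k) (of_nat (l mod p)) \<le> r ^ N * r"
    using Suc.prems(3) by (simp add: mult.commute)
  then have "dist (of_nat (k mod p) :: 'k) (of_nat (l mod p)) \<le> r"
    using r by simp
  then have "k mod p = l mod p"
    using p by (intro residue_unique) auto
  with div show ?case
    by (metis div_mult_mod_eq)
qed

lemma disc_unique:
  assumes "k < p ^ N" "l < p ^ N" "x \<in> disc N k" "x \<in> disc N l"
  shows "k = l"
  using assms dist_le_trans[of "trunc N k" x _ "trunc N l"]
  by (intro trunc_unique) (auto simp: disc_def dist_commute)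

text \<open>In an ultrametric space every point of a ball is a centre of it, so of two balls that
  meet the smaller lies in the larger.\<close>

lemma disc_subset_disc:
  assumes "N \<le> M" "x \<in> disc N k" "x \<in> disc M l"
  shows "disc M l \<subseteq> disc N k"
proof
  fix y assume "y \<in> disc M l"
  then have "dist y (trunc M l) \<le> r ^ N" "dist (trunc M l) x \<le> r ^ N"
    using assms power_r_mono[of N M] by (auto simp: disc_def dist_commute)
  then have "dist y x \<le> r ^ N"
    by (rule dist_le_trans)
  then show "y \<in> disc N k"
    using assms(2) unfolding disc_def mem_Collect_eq by (rule dist_le_trans)
qed

text \<open>Two discs are nested or disjoint; the empty set is adjoined for the disjoint
  case.\<close>

lemma Int_stable_discs: "Int_stable (insert {} {disc N k |N k. k < p ^ N})"
proof -
  have *: "disc N k \<inter> disc M l \<in> {{}, disc N k, disc M l}" for N k M l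
  proof (cases "disc N k \<inter> disc M l = {}")
    case False
    then obtain x where "x \<in> disc N k" "x \<in> disc M l" by blast
    then show ?thesis
      using disc_subset_disc[of N M x k l] disc_subset_disc[of M N x l k] by (cases "N \<le> M") auto
  qed simp
  show ?thesis
  proof (rule Int_stableI)
    fix A B assume "A \<in> insert {} {disc N k |N k. k < p ^ N}" "B \<in> insert {} {disc N k |N k. k < p ^ N}"
    then consider "A \<inter> B = {}" | N k M l where "A = disc N k" "B = disc M l" "k < p ^ N" "l < p ^ M"
      by blast
    then show "A \<inter> B \<in> insert {} {disc N k |N k. k < p ^ N}"
    proof cases
      case 2
      then show ?thesis using *[of N k M l] by auto
    qed simp
  qed
qed

lemma closed_disc: "closed (disc N k)"
proof -
  have "disc N k = cball (trunc N k) (r ^ N)"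
    by (auto simp: disc_def dist_commute)
  then show ?thesis by simp
qed

text \<open>Together with translation invariance this forces all discs of one level to have the same
  Haar measure.\<close>

lemma disc_eq_translate: "disc N k = (+) (trunc N k) ` disc N 0"
proof -
  have [simp]: "trunc N 0 = 0"
    by (induction N) auto
  show ?thesis
  proof (intro equalityI subsetI)
    fix x assume "x \<in> disc N k"
    then have "x - trunc N k \<in> disc N 0"
      by (simp add: disc_def dist_diff_0)
    then show "x \<in> (+) (trunc N k) ` disc N 0"
      by (rule rev_image_eqI) simp
  next
    fix x assume "x \<in> (+) (trunc N k) ` disc N 0"
    then obtain y where "x = y + trunc N k" "dist y 0 \<le> r ^ N"
      by (auto simp: disc_def add.commute)
    then show "x \<in> disc N k"
      using dist_add[of y "trunc N k" 0] by (simp add: disc_def)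
  qed
qed

section \<open>The digit map on intervals and discs\<close>

abbreviation phi :: "real \<Rightarrow> 'k" where
  "phi \<equiv> varrho p \<pi>"

lemma digit_less:
  assumes "x \<in> {0..1}"
  shows "digit p x i < p"
  using assms p greedy_digit_eq[of p x i] by (cases "x = 1") (auto simp: digit_def)

text \<open>The first \<open>N\<close> digits depend on \<open>x\<close> only through the integer
  part of p^N x. The point 1 is excluded: there the integer part is p^N, whose last \<open>N\<close>
  digits vanish, while the digits of 1 are all p - 1.\<close>

lemma sum_digits_eq_trunc:
  assumes "0 \<le> x" "x < 1"
  shows "(\<Sum>i<N. of_nat (digit p x i) * \<pi> ^ i) = trunc N (nat \<lfloor>real p ^ N * x\<rfloor>)"
proof (induction N)
  case (Suc N)
  have "digit p x N = nat \<lfloor>real p ^ Suc N * x\<rfloor> mod p"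
    using assms p greedy_digit_eq[of p x N] by (simp add: digit_def)
  then show ?case
    using Suc floor_power_div[of p x N] p assms by simp
qed simp

lemma sum_digits_tendsto:
  assumes "x \<in> {0..1}"
  shows "(\<lambda>N. \<Sum>i<N. of_nat (digit p x i) * \<pi> ^ i) \<longlonglongrightarrow> phi x"
  unfolding varrho_def by (rule summable_LIMSEQ) (rule summable_digits[OF digit_less[OF assms]])

text \<open>Every later term moves the partial sum by at most \<open>r ^ N\<close>. By the
  ultrametric inequality these moves do not add up, so all later partial sums stay in one closed
  ball, and so does the limit.\<close>

lemma dist_phi_sum_digits_le:
  assumes "x \<in> {0..1}"
  shows "dist (phi x) (\<Sum>i<N. of_nat (digit p x i) * \<pi> ^ i) \<le> r ^ N"
proof -
  define S where "S n = (\<Sum>i<n. of_nat (digit p x i) * \<pi> ^ i)" for n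
  have le: "dist (S (m + N)) (S N) \<le> r ^ N" for m
  proof (induction m)
    case 0
    then show ?case using r by simp
  next
    case (Suc m)
    have "dist (S (Suc m + N)) (S (m + N)) \<le> r ^ (m + N)"
      using dist_digit_le by (simp add: S_def)
    also have "\<dots> \<le> r ^ N"
      by (rule power_r_mono) simp
    finally show ?case
      using Suc by (rule dist_le_trans)
  qed
  have "(\<lambda>m. S (m + N)) \<longlonglongrightarrow> phi x"
    using sum_digits_tendsto[OF assms] unfolding S_def by (rule LIMSEQ_ignore_initial_segment)
  then have "phi x \<in> cball (S N) (r ^ N)"
    by (rule closed_sequentially[rotated 2]) (use le in \<open>auto simp: dist_commute\<close>)
  then show ?thesis
    by (simp add: S_def dist_commute)
qed

lemma phi_mem_disc:
  assumes "0 \<le> x" "x < 1"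
  shows "phi x \<in> disc N (nat \<lfloor>real p ^ N * x\<rfloor>)"
  using dist_phi_sum_digits_le[of x N] assms by (simp add: disc_def sum_digits_eq_trunc)

text \<open>\<open>phi x\<close> lies in the disc indexed by the integer part of p^N x, and discs of
  one level are disjoint, so membership determines this integer part.\<close>

lemma phi_mem_disc_iff:
  assumes "0 \<le> x" "x < 1" "k < p ^ N"
  shows "phi x \<in> disc N k \<longleftrightarrow> real k / real p ^ N \<le> x \<and> x < (real k + 1) / real p ^ N"
proof -
  have "nat \<lfloor>real p ^ N * x\<rfloor> < p ^ N"
    using assms p by (intro floor_power_less) auto
  then have "phi x \<in> disc N k \<longleftrightarrow> k = nat \<lfloor>real p ^ N * x\<rfloor>"
    using disc_unique[OF assms(3) _ _ phi_mem_disc[OF assms(1,2)]] phi_mem_disc[OF assms(1,2)] by blast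
  also have "\<dots> \<longleftrightarrow> \<lfloor>real p ^ N * x\<rfloor> = int k"
    using assms by auto
  also have "\<dots> \<longleftrightarrow> real k \<le> real p ^ N * x \<and> real p ^ N * x < real k + 1"
    by (simp add: floor_eq_iff)
  also have "\<dots> \<longleftrightarrow> real k / real p ^ N \<le> x \<and> x < (real k + 1) / real p ^ N"
    using p by (simp add: field_simps)
  finally show ?thesis .
qed

lemma phi_integral:
  assumes "x \<in> {0..1}"
  shows "phi x \<in> \<O>"
  using dist_phi_sum_digits_le[OF assms, of 0] by (simp add: ring_of_integers_def)

lemma phi_measurable: "phi \<in> lebesgue_on {0..1} \<rightarrow>\<^sub>M borel"
proof (rule borel_measurable_LIMSEQ_metric)
  fix N
  \<comment> \<open>The partial sum factors through a discrete space, from which every map is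
    measurable. The \<open>else\<close> branch below gives the right value at the only remaining
    point, 1.\<close>
  have "(\<lambda>x. nat \<lfloor>real p ^ N * x\<rfloor>) \<in> borel \<rightarrow>\<^sub>M count_space UNIV"
    by measurable
  then have "(\<lambda>x. trunc N (nat \<lfloor>real p ^ N * x\<rfloor>)) \<in> borel \<rightarrow>\<^sub>M borel"
    by (rule measurable_compose) simp
  then have "(\<lambda>x. if x < 1 then trunc N (nat \<lfloor>real p ^ N * x\<rfloor>)
      else (\<Sum>i<N. of_nat (digit p 1 i) * \<pi> ^ i)) \<in> borel \<rightarrow>\<^sub>M borel"
    by measurable
  then have "(\<lambda>x. if x < 1 then trunc N (nat \<lfloor>real p ^ N * x\<rfloor>)
      else (\<Sum>i<N. of_nat (digit p 1 i) * \<pi> ^ i)) \<in> lebesgue_on {0..1} \<rightarrow>\<^sub>M borel"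
    by (intro measurable_restrict_space1 measurable_completion) simp
  then show "(\<lambda>x. \<Sum>i<N. of_nat (digit p x i) * \<pi> ^ i) \<in> lebesgue_on {0..1} \<rightarrow>\<^sub>M borel"
    by (rule measurable_cong[THEN iffD1, rotated]) (auto simp: sum_digits_eq_trunc)
qed (use sum_digits_tendsto in simp)

lemma emeasure_phi_preimage:
  assumes k: "k < p ^ N"
  shows "emeasure (lebesgue_on {0..1}) (phi -` disc N k \<inter> {0..1}) = ennreal (1 / real p ^ N)"
proof -
  let ?I = "{real k / real p ^ N..<(real k + 1) / real p ^ N}"
  have sets: "phi -` disc N k \<inter> {0..1} \<in> sets (lebesgue_on {0..1})"
    using measurable_sets[OF phi_measurable borel_closed[OF closed_disc]] by simp
  have pos: "real p ^ N > 0"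
    using p by simp
  have le1: "(real k + 1) / real p ^ N \<le> 1"
    using k p by (simp add: Suc_le_eq flip: of_nat_Suc of_nat_power)
  have "x \<in> phi -` disc N k \<inter> {0..1} \<longleftrightarrow> x \<in> ?I" if "x \<noteq> 1" for x
  proof -
    have "0 \<le> real k / real p ^ N"
      by simp
    with le1 have "0 \<le> x \<and> x < 1" if "x \<in> ?I"
      using that by (simp only: atLeastLessThan_iff) linarith
    then show ?thesis
      using phi_mem_disc_iff[OF _ _ k, of x] \<open>x \<noteq> 1\<close> by auto
  qed
  \<comment> \<open>The digits at 1 do not come from the greedy algorithm, so preimage and interval
    are compared off this null set.\<close>
  moreover have "AE x in lebesgue. x \<noteq> (1 :: real)"
    by (rule AE_completion) (rule AE_lborel_singleton)
  ultimately have ae: "AE x in lebesgue. x \<in> phi -` disc N k \<inter> {0..1} \<longleftrightarrow> x \<in> ?I"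
    by (auto elim: eventually_mono)
  have "emeasure (lebesgue_on {0..1}) (phi -` disc N k \<inter> {0..1}) =
      emeasure lebesgue (phi -` disc N k \<inter> {0..1})"
    by (rule emeasure_restrict_space) auto
  also have "\<dots> = emeasure lebesgue ?I"
    using sets by (intro emeasure_eq_AE[OF ae]) (auto simp: sets_restrict_space_iff)
  also have "\<dots> = ennreal (1 / real p ^ N)"
    using pos by (simp add: divide_right_mono flip: diff_divide_distrib)
  finally show ?thesis .
qed

lemma discs_cover: "(\<Union>k<p ^ N. disc N k) = \<O>"
  using ex_disc disc_subset by fast

text \<open>The radii \<open>r ^ N\<close> tend to 0, so each integral point of \<open>U\<close> has
  a disc inside \<open>U\<close>. There are only countably many discs, hence the union of those
  inside \<open>U\<close> is in the generated sigma-algebra.\<close>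

lemma open_inter_integers:
  assumes "open U"
  shows "\<O> \<inter> U \<in> sigma_sets \<O> (insert {} {disc N k |N k. k < p ^ N})" (is "_ \<in> sigma_sets _ ?E")
proof -
  let ?B = "{disc N k |N k. k < p ^ N \<and> disc N k \<subseteq> U}"
  have mem: "x \<in> \<Union>?B" if x: "x \<in> \<O>" "x \<in> U" for x
  proof -
    obtain e where e: "e > 0" "ball x e \<subseteq> U"
      using assms x by (meson open_contains_ball)
    obtain N where N: "r ^ N < e"
      using real_arch_pow_inv[OF e(1) r(2)] by blast
    obtain k where k: "k < p ^ N" "x \<in> disc N k"
      using ex_disc[OF x(1)] by blast
    have "disc N k \<subseteq> ball x e"
    proof
      fix y assume "y \<in> disc N k"
      then have "dist x y \<le> r ^ N"
        using k(2) by (auto simp: disc_def dist_commute intro: dist_le_trans)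
      with N show "y \<in> ball x e" by simp
    qed
    with e(2) have "disc N k \<subseteq> U"
      by (rule subset_trans[rotated])
    with k(1) have "disc N k \<in> ?B"
      by blast
    then show ?thesis
      using k(2) by (rule UnionI)
  qed
  have "\<O> \<inter> U \<subseteq> \<Union>?B"
    by (rule subsetI, erule IntE, rule mem)
  moreover have "\<Union>?B \<subseteq> \<O> \<inter> U"
    using disc_subset by (intro Union_least) auto
  ultimately have "\<O> \<inter> U = \<Union>?B"
    by (rule equalityI)
  moreover have "countable ?B"
    by (rule countable_subset[of _ "range (\<lambda>(N, k). disc N k)"]) auto
  then have "\<Union>?B \<in> sigma_sets \<O> ?E"
    by (rule sigma_sets_UNION) (auto intro: sigma_sets.Basic)
  ultimately show ?thesis by simp
qed

section \<open>Haar measure of discs and measure preservation\<close>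

context
  fixes \<mu> :: "'k measure"
  assumes haar: "normalized_haar_measure \<mu>"
begin

lemma sets_haar: "sets \<mu> = sets borel"
  using haar by (simp add: normalized_haar_measure_def haar_measure_def)

lemma space_haar: "space \<mu> = UNIV"
  using sets_eq_imp_space_eq[OF sets_haar] by simp

lemma disc_in_sets: "disc N k \<in> sets \<mu>"
  unfolding sets_haar by (rule borel_closed[OF closed_disc])

lemma integers_in_sets: "\<O> \<in> sets \<mu>"
  using disc_in_sets[of 0 0] by (simp add: disc_0)

text \<open>The \<open>p ^ N\<close> discs of level \<open>N\<close> are disjoint translates of one
  another and fill \<O>, which has measure 1.\<close>

lemma emeasure_disc: "emeasure \<mu> (disc N k) = ennreal (1 / real p ^ N)"
proof -
  have m: "emeasure \<mu> (disc N k) = emeasure \<mu> (disc N 0)" for k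
    using haar disc_in_sets disc_eq_translate[of N k]
    by (simp add: normalized_haar_measure_def haar_measure_def)
  have "(\<Sum>k<p ^ N. emeasure \<mu> (disc N k)) = emeasure \<mu> (\<Union>k<p ^ N. disc N k)"
    using disc_unique disc_in_sets
    by (intro sum_emeasure) (auto simp: disjoint_family_on_def)
  also have "\<dots> = 1"
    using haar by (simp add: discs_cover normalized_haar_measure_def)
  finally have 1: "of_nat (p ^ N) * emeasure \<mu> (disc N 0) = 1"
    by (subst (asm) m) simp
  have "ennreal (1 / real p ^ N) * of_nat (p ^ N) = 1"
    using p by (simp add: ennreal_of_nat_eq_real_of_nat flip: ennreal_mult)
  then have "emeasure \<mu> (disc N 0) = ennreal (1 / real p ^ N) * (of_nat (p ^ N) * emeasure \<mu> (disc N 0))"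
    by (simp only: mult.assoc[symmetric] mult_1)
  then show ?thesis
    unfolding 1 m[of k] by simp
qed

text \<open>The trace on \<O> of the Borel sigma-algebra is generated by the traces of open sets,
  and these are countable unions of discs.\<close>

lemma sets_integers:
  "sets (restrict_space \<mu> \<O>) = sigma_sets \<O> (insert {} {disc N k |N k. k < p ^ N})"
  (is "_ = sigma_sets _ ?E")
proof (intro equalityI)
  have "sets (restrict_space \<mu> \<O>) = (\<inter>) \<O> ` sigma_sets UNIV {S. open S}"
    by (simp add: sets_restrict_space sets_haar borel_def)
  also have "\<dots> = sigma_sets \<O> ((\<inter>) \<O> ` {S. open S})"
    using integers_in_sets by (intro sigma_sets_Int) (simp_all add: sets_haar borel_def)
  also have "\<dots> \<subseteq> sigma_sets \<O> ?E"
    by (rule sigma_sets_mono) (auto intro: open_inter_integers)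
  finally show "sets (restrict_space \<mu> \<O>) \<subseteq> sigma_sets \<O> ?E" .
next
  have "?E \<subseteq> sets (restrict_space \<mu> \<O>)"
    using disc_in_sets disc_subset integers_in_sets
    by (auto simp: sets_restrict_space_iff space_haar)
  then show "sigma_sets \<O> ?E \<subseteq> sets (restrict_space \<mu> \<O>)"
    using sets.sigma_sets_subset[of ?E "restrict_space \<mu> \<O>"] by (simp add: space_restrict_space space_haar)
qed

lemma phi_measurable_integers: "phi \<in> lebesgue_on {0..1} \<rightarrow>\<^sub>M restrict_space \<mu> \<O>"
proof (rule measurable_restrict_space2)
  show "phi \<in> lebesgue_on {0..1} \<rightarrow>\<^sub>M \<mu>"
    using phi_measurable by (simp cong: measurable_cong_sets add: sets_haar)
qed (auto simp: phi_integral)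

lemma distr_phi: "distr (lebesgue_on {0..1}) (restrict_space \<mu> \<O>) phi = restrict_space \<mu> \<O>"
\<comment> \<open>Uniqueness of measures on an intersection-stable generator. The constant sequence
  \<O> exhausts the space, being itself the disc of level 0 and of finite measure.\<close>
proof (rule measure_eqI_generator_eq[OF Int_stable_discs, where A = "\<lambda>_. \<O>" and \<Omega> = "\<O>"])
  show "insert {} {disc N k |N k. k < p ^ N} \<subseteq> Pow \<O>"
    using disc_subset by blast
  have mem: "\<O> \<in> {disc N k |N k. k < p ^ N}"
    using disc_0[of 0] by (intro CollectI exI[of _ 0]) simp
  then show "range (\<lambda>_::nat. \<O>) \<subseteq> insert {} {disc N k |N k. k < p ^ N}"
    by blast
  have "emeasure (distr (lebesgue_on {0..1}) (restrict_space \<mu> \<O>) phi) (disc N k) =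
      emeasure (restrict_space \<mu> \<O>) (disc N k) \<and>
      emeasure (restrict_space \<mu> \<O>) (disc N k) = ennreal (1 / real p ^ N)"
    if k: "k < p ^ N" for N k
  proof -
    have "disc N k \<in> sets (restrict_space \<mu> \<O>)"
      using disc_in_sets disc_subset integers_in_sets by (simp add: sets_restrict_space_iff space_haar)
    then have "emeasure (distr (lebesgue_on {0..1}) (restrict_space \<mu> \<O>) phi) (disc N k) = ennreal (1 / real p ^ N)"
      using emeasure_phi_preimage[OF k] by (simp add: emeasure_distr[OF phi_measurable_integers])
    moreover have "emeasure (restrict_space \<mu> \<O>) (disc N k) = ennreal (1 / real p ^ N)"
      using disc_subset integers_in_sets by (simp add: emeasure_restrict_space emeasure_disc space_haar)
    ultimately show ?thesis by simp
  qed
  then show "emeasure (distr (lebesgue_on {0..1}) (restrict_space \<mu> \<O>) phi) X =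
      emeasure (restrict_space \<mu> \<O>) X"
    if "X \<in> insert {} {disc N k |N k. k < p ^ N}" for X
    using that by auto
  show "emeasure (distr (lebesgue_on {0..1}) (restrict_space \<mu> \<O>) phi) \<O> \<noteq> \<infinity>"
    using phi_integral emeasure_phi_preimage[of 0 0] integers_in_sets
    by (subst emeasure_distr[OF phi_measurable_integers]) (auto simp: sets_restrict_space_iff space_haar disc_0)
qed (simp_all add: sets_integers)

text \<open>
  The reverse digit map from \<open>\<O>\<close> to \<open>{0..1}\<close>, as a limit of functions constant on discs, is
  measurable for free and inverts \<^const>\<open>varrho\<close> off the endpoint \<open>1\<close>.
\<close>

definition psi :: "'k \<Rightarrow> real" where
  "psi y = lim (\<lambda>N. \<Sum>k<p ^ N. real k / real p ^ N * indicator (disc N k) y)"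

lemma psi_measurable: "psi \<in> borel_measurable (restrict_space \<mu> \<O>)"
proof -
  have [measurable]: "disc N k \<in> sets \<mu>" for N k
    by (rule disc_in_sets)
  have "psi \<in> borel_measurable \<mu>"
    unfolding psi_def[abs_def] by measurable
  then show ?thesis
    by (rule measurable_restrict_space1)
qed

text \<open>Exactly one disc of level \<open>N\<close> contains \<open>phi x\<close>, so the sum in
  \<open>psi\<close> reduces to the truncation of \<open>x\<close> to \<open>N\<close> digits, which
  is within p^-N of \<open>x\<close>.\<close>

lemma psi_phi:
  assumes x: "0 \<le> x" "x < 1"
  shows "psi (phi x) = x"
proof -
  have pos: "real p ^ N > 0" for N
    using p by simp
  have sum: "(\<Sum>k<p ^ N. real k / real p ^ N * indicator (disc N k) (phi x)) =
      real (nat \<lfloor>real p ^ N * x\<rfloor>) / real p ^ N" for N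
  proof -
    let ?k = "nat \<lfloor>real p ^ N * x\<rfloor>"
    have k: "?k < p ^ N"
      using x p by (intro floor_power_less) auto
    have "indicator (disc N k) (phi x) = (if k = ?k then 1 else 0 :: real)" if "k < p ^ N" for k
      using disc_unique[OF that k] phi_mem_disc[OF x, of N] by (auto simp: indicator_def)
    then have "(\<Sum>k<p ^ N. real k / real p ^ N * indicator (disc N k) (phi x)) =
        (\<Sum>k<p ^ N. if k = ?k then real k / real p ^ N else 0)"
      by (intro sum.cong) auto
    with k show ?thesis by simp
  qed
  have "(\<lambda>N. real (nat \<lfloor>real p ^ N * x\<rfloor>) / real p ^ N) \<longlonglongrightarrow> x"
  proof (rule metric_tendsto_imp_tendsto)
    show "(\<lambda>N. (1 / real p) ^ N) \<longlonglongrightarrow> 0"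
      using p by (intro LIMSEQ_power_zero) simp
    have "dist (real (nat \<lfloor>real p ^ N * x\<rfloor>) / real p ^ N) x \<le> (1 / real p) ^ N" for N
    proof -
      have "real (nat \<lfloor>real p ^ N * x\<rfloor>) \<le> real p ^ N * x"
        "real p ^ N * x \<le> real (nat \<lfloor>real p ^ N * x\<rfloor>) + 1"
        using x p by simp_all
      then have "real (nat \<lfloor>real p ^ N * x\<rfloor>) / real p ^ N \<le> x"
        "x \<le> (real (nat \<lfloor>real p ^ N * x\<rfloor>) + 1) / real p ^ N"
        using pos[of N] by (simp_all only: pos_divide_le_eq pos_le_divide_eq mult.commute)
      then have "real (nat \<lfloor>real p ^ N * x\<rfloor>) / real p ^ N \<le> x"
        "x \<le> real (nat \<lfloor>real p ^ N * x\<rfloor>) / real p ^ N + 1 / real p ^ N"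
        by (simp_all only: add_divide_distrib)
      then show ?thesis
        by (simp add: dist_real_def power_one_over)
    qed
    then show "\<forall>\<^sub>F N in sequentially. dist (real (nat \<lfloor>real p ^ N * x\<rfloor>) / real p ^ N) x
        \<le> dist ((1 / real p) ^ N) 0"
      by (simp add: always_eventually)
  qed
  then show ?thesis
    unfolding psi_def sum by (rule limI)
qed

text \<open>Composition with \<open>psi\<close> is safe only for Borel functions, so
  \<open>g\<close> is extended by 0 and replaced by a Borel \<open>h\<close> equal to it almost
  everywhere. Then \<open>h\<close> composed with \<open>psi\<close> pulls back to \<open>h\<close>
  off the point 1.\<close>

lemma ex_pullback_AE_eq:
  fixes g :: "real \<Rightarrow> real"
  assumes "g \<in> borel_measurable (lebesgue_on {0..1})"
  shows "\<exists>f\<in>borel_measurable (restrict_space \<mu> \<O>). AE x in lebesgue_on {0..1}. f (phi x) = g x"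
proof -
  have "(\<lambda>x. indicator {0..1} x *\<^sub>R g x) \<in> borel_measurable lebesgue"
    using assms by (subst (asm) borel_measurable_restrict_space_iff) auto
  from completion_ex_borel_measurable_real[OF this[simplified real_scaleR_def]] obtain h
    where h: "h \<in> borel_measurable lborel" "AE x in lborel. indicator {0..1} x * g x = h x"
    by blast
  have "(\<lambda>y. h (psi y)) \<in> borel_measurable (restrict_space \<mu> \<O>)"
    using h(1) by (intro measurable_compose[OF psi_measurable]) simp
  moreover have "AE x in lborel. x \<in> {0..1} \<longrightarrow> h (psi (phi x)) = g x"
    using h(2) AE_lborel_singleton[of 1] by eventually_elim (auto simp: psi_phi)
  then have "AE x in lebesgue_on {0..1}. h (psi (phi x)) = g x"
    by (simp add: AE_restrict_space_iff AE_completion_iff)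
  ultimately show ?thesis
    by (intro bexI[of _ "\<lambda>y. h (psi y)"])
qed

lemma varrho_pullback_isometry:
  "pullback_well_defined \<rho> (restrict_space \<mu> \<O>) (lebesgue_on {0..1}) phi \<and>
   linear_surjective_isometry \<rho> (restrict_space \<mu> \<O>) (lebesgue_on {0..1})
     (pullback (lebesgue_on {0..1}) phi)"
proof
  show "pullback_well_defined \<rho> (restrict_space \<mu> \<O>) (lebesgue_on {0..1}) phi"
    by (rule pullback_well_definedI[OF phi_measurable_integers distr_phi])
  show "linear_surjective_isometry \<rho> (restrict_space \<mu> \<O>) (lebesgue_on {0..1})
      (pullback (lebesgue_on {0..1}) phi)"
    by (rule linear_surjective_isometry_pullback[OF phi_measurable_integers distr_phi])
      (rule ex_pullback_AE_eq)
qed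

end

end

section \<open>The two local fields\<close>

lemma padic_norm_tendsto:
  assumes "padic_cauchy CARD('p) X"
  shows "(\<lambda>n. padic_abs CARD('p) (X n)) \<longlonglongrightarrow> padic_norm (abs_padic X :: 'p::prime_card padic)"
proof -
  have "padic_norm (abs_padic X :: 'p padic) = lim (\<lambda>n. padic_abs CARD('p) (X n))"
    using assms by (intro padic_norm.abs_eq) (simp add: padic_rel_refl_iff)
  then show ?thesis
    using padic_cauchy_abs_convergent[OF prime_card assms] by (simp add: convergent_LIMSEQ_iff)
qed

lemma padic_abs_cases:
  fixes x :: "'p::prime_card padic"
  obtains X where "padic_cauchy CARD('p) X" "x = abs_padic X"
  using rep_padic by blast

lemma abs_padic_plus:
  "padic_cauchy CARD('p) X \<Longrightarrow> padic_cauchy CARD('p) Y \<Longrightarrow>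
    abs_padic X + abs_padic Y = (abs_padic (\<lambda>n. X n + Y n) :: 'p::prime_card padic)"
  by (rule plus_padic.abs_eq) (simp_all add: padic_rel_refl_iff)

lemma abs_padic_times:
  "padic_cauchy CARD('p) X \<Longrightarrow> padic_cauchy CARD('p) Y \<Longrightarrow>
    abs_padic X * abs_padic Y = (abs_padic (\<lambda>n. X n * Y n) :: 'p::prime_card padic)"
  by (rule times_padic.abs_eq) (simp_all add: padic_rel_refl_iff)

lemma abs_padic_diff:
  assumes "padic_cauchy CARD('p) X" "padic_cauchy CARD('p) Y"
  shows "abs_padic X - abs_padic Y = (abs_padic (\<lambda>n. X n - Y n) :: 'p::prime_card padic)"
proof -
  have "- abs_padic Y = (abs_padic (\<lambda>n. - Y n) :: 'p padic)"
    using assms by (intro uminus_padic.abs_eq) (simp add: padic_rel_refl_iff)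
  then show ?thesis
    using assms by (simp add: minus_padic_def abs_padic_plus padic_cauchy_minus[OF prime_card])
qed

lemma padic_norm_mult: "padic_norm (x * y) = padic_norm x * padic_norm (y :: 'p::prime_card padic)"
proof -
  obtain X Y where X: "padic_cauchy CARD('p) X" "x = abs_padic X"
    and Y: "padic_cauchy CARD('p) Y" "y = abs_padic Y"
    by (meson padic_abs_cases)
  have "(\<lambda>n. padic_abs CARD('p) (X n * Y n)) \<longlonglongrightarrow> padic_norm (x * y)"
    using X Y by (simp add: abs_padic_times padic_norm_tendsto padic_cauchy_mult[OF prime_card])
  moreover have "(\<lambda>n. padic_abs CARD('p) (X n * Y n)) \<longlonglongrightarrow> padic_norm x * padic_norm y"
    unfolding padic_abs_mult[OF prime_card] X(2) Y(2)
    by (intro tendsto_mult padic_norm_tendsto X Y)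
  ultimately show ?thesis
    by (rule LIMSEQ_unique)
qed

lemma padic_norm_ultra:
  "padic_norm (x + y) \<le> max (padic_norm x) (padic_norm (y :: 'p::prime_card padic))"
proof -
  obtain X Y where X: "padic_cauchy CARD('p) X" "x = abs_padic X"
    and Y: "padic_cauchy CARD('p) Y" "y = abs_padic Y"
    by (meson padic_abs_cases)
  have "(\<lambda>n. padic_abs CARD('p) (X n + Y n)) \<longlonglongrightarrow> padic_norm (x + y)"
    using X Y by (simp add: abs_padic_plus padic_norm_tendsto padic_cauchy_add[OF prime_card])
  moreover have "(\<lambda>n. max (padic_abs CARD('p) (X n)) (padic_abs CARD('p) (Y n)))
      \<longlonglongrightarrow> max (padic_norm x) (padic_norm y)"
    unfolding X(2) Y(2) by (intro tendsto_max padic_norm_tendsto X Y)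
  ultimately show ?thesis
    by (rule LIMSEQ_le) (use padic_abs_ultra[OF prime_card] in blast)
qed

lemma padic_norm_const: "padic_norm (abs_padic (\<lambda>_. q) :: 'p::prime_card padic) = padic_abs CARD('p) q"
  using padic_norm_tendsto[OF padic_cauchy_const[OF prime_card], of q, where 'p = 'p]
  by (simp add: LIMSEQ_const_iff)

lemma padic_of_nat: "of_nat n = (abs_padic (\<lambda>_. of_nat n) :: 'p::prime_card padic)"
proof (induction n)
  case 0
  then show ?case by (simp add: zero_padic_def)
next
  case (Suc n)
  then show ?case
    using padic_cauchy_const[OF prime_card[where 'a = 'p]]
    by (simp add: one_padic_def abs_padic_plus)
qed

lemma padic_abs_of_int:
  assumes "prime p" "z \<noteq> 0"
  shows "padic_abs p (of_int z) = (1 / real p) ^ multiplicity (int p) z"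
  using padic_abs_frac[OF assms(1,2), of 1]
  by (simp add: power_int_minus power_int_def field_simps)

lemma padic_abs_of_int_le_1:
  assumes "prime p"
  shows "padic_abs p (of_int z) \<le> 1"
proof (cases "z = 0")
  case False
  have "real p \<ge> 1"
    using prime_gt_0_nat[OF assms] by simp
  with False show ?thesis
    using assms by (simp add: padic_abs_of_int power_le_one)
qed (simp add: padic_abs_0[OF assms])

text \<open>The absolute value of a nonzero integer is a power of 1/p whose exponent is the
  multiplicity of \<open>p\<close>, so the bound says that this exponent is at least 1.\<close>

lemma padic_abs_of_int_le_inverse_iff:
  assumes "prime p"
  shows "padic_abs p (of_int z) \<le> 1 / real p \<longleftrightarrow> int p dvd z"
proof (cases "z = 0")
  case False
  have p: "1 / real p < 1" "1 / real p > 0"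
    using prime_gt_1_nat[OF assms] by simp_all
  have "padic_abs p (of_int z) \<le> 1 / real p \<longleftrightarrow> (1 / real p) ^ multiplicity (int p) z \<le> (1 / real p) ^ 1"
    using False assms by (simp add: padic_abs_of_int)
  also have "\<dots> \<longleftrightarrow> multiplicity (int p) z \<ge> 1"
    using p by (rule power_decreasing_iff[rotated])
  also have "\<dots> \<longleftrightarrow> int p dvd z"
    using False assms by (simp add: Suc_le_eq prime_multiplicity_gt_zero_iff)
  finally show ?thesis .
qed (simp add: padic_abs_0[OF assms])

text \<open>A p-integral fraction a/b in lowest terms has denominator prime to \<open>p\<close>; the
  residue is \<open>a\<close> times an inverse of \<open>b\<close> modulo \<open>p\<close>.\<close>

lemma padic_abs_residue:
  assumes p: "prime p" and q: "padic_abs p q \<le> 1"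
  shows "\<exists>d<p. padic_abs p (q - of_nat d) \<le> 1 / real p"
proof -
  obtain a b where ab: "quotient_of q = (a, b)"
    by (cases "quotient_of q")
  have qab: "q = of_int a / of_int b"
    using ab by (rule quotient_of_div)
  have b: "b > 0"
    using ab by (rule quotient_of_denom_pos)
  have cop: "coprime a b"
    using ab by (rule quotient_of_coprime)
  have pp: "prime (int p)"
    using p by simp
  \<comment> \<open>If \<open>p\<close> divided \<open>b\<close>, it would not divide
    \<open>a\<close>, so |a| = 1, whereas |a| = |q| |b| is at most |b| < 1.\<close>
  have ndvd: "\<not> int p dvd b"
  proof
    assume dvd: "int p dvd b"
    then have "\<not> int p dvd a"
      using cop pp by (meson coprime_common_divisor not_prime_unit)
    then have a: "padic_abs p (of_int a) = 1"
      using padic_abs_of_int[OF p, of a] by (cases "a = 0") (auto simp: not_dvd_imp_multiplicity_0)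
    have "padic_abs p (of_int b) < 1"
      using dvd padic_abs_of_int_le_inverse_iff[OF p, of b] prime_gt_1_nat[OF p]
      by (auto intro: le_less_trans)
    moreover have "padic_abs p (of_int a) = padic_abs p q * padic_abs p (of_int b)"
      using b by (simp add: qab flip: padic_abs_mult[OF p])
    moreover have "padic_abs p q * padic_abs p (of_int b) \<le> 1 * padic_abs p (of_int b)"
      using q by (intro mult_right_mono) (simp_all add: padic_abs_nonneg[OF p])
    ultimately show False
      using a by simp
  qed
  then have "coprime b (int p)"
    using pp prime_imp_coprime coprime_commute by blast
  then obtain c where c: "[b * c = 1] (mod int p)"
    using cong_solve_coprime_int by blast
  define d where "d = nat ((a * c) mod int p)"
  have p0: "int p > 0"
    using prime_gt_0_nat[OF p] by simp
  then have d: "int d = (a * c) mod int p"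
    by (simp add: d_def)
  have "d < p"
    using p0 d by (metis of_nat_less_iff pos_mod_bound)
  have "[b * int d = b * (a * c)] (mod int p)"
    unfolding d by (intro cong_mult cong_refl) (simp add: cong_def)
  also have "[b * (a * c) = a] (mod int p)"
    using cong_mult[OF cong_refl[of a] c] by (simp add: ac_simps)
  finally have dvd: "int p dvd a - b * int d"
    by (simp add: cong_iff_dvd_diff dvd_diff_commute)
  \<comment> \<open>Since \<open>b\<close> is a unit, clearing the denominator leaves the absolute
    value unchanged and reduces the claim to divisibility of an integer.\<close>
  have "padic_abs p (of_int b) = 1"
    using padic_abs_of_int[OF p, of b] b ndvd by (simp add: not_dvd_imp_multiplicity_0)
  moreover have "(q - of_nat d) * of_int b = of_int (a - b * int d)"
    using b by (simp add: qab left_diff_distrib)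
  then have "padic_abs p (q - of_nat d) * padic_abs p (of_int b) = padic_abs p (of_int (a - b * int d))"
    by (simp only: flip: padic_abs_mult[OF p])
  ultimately have "padic_abs p (q - of_nat d) \<le> 1 / real p"
    using dvd padic_abs_of_int_le_inverse_iff[OF p, of "a - b * int d"] by simp
  with \<open>d < p\<close> show ?thesis by blast
qed

lemma padic_rat_approx:
  fixes x :: "'p::prime_card padic"
  assumes "e > 0"
  shows "\<exists>q. padic_norm (x - abs_padic (\<lambda>_. q)) \<le> e"
proof -
  obtain X where X: "padic_cauchy CARD('p) X" "x = abs_padic X"
    by (rule padic_abs_cases)
  obtain N where N: "\<forall>m\<ge>N. \<forall>n\<ge>N. padic_abs CARD('p) (X m - X n) < e"
    using X(1) assms unfolding padic_cauchy_def by blast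
  have "x - abs_padic (\<lambda>_. X N) = abs_padic (\<lambda>n. X n - X N)"
    unfolding X(2) by (rule abs_padic_diff[OF X(1) padic_cauchy_const[OF prime_card]])
  moreover have "padic_cauchy CARD('p) (\<lambda>n. X n - X N)"
    using padic_cauchy_add[OF prime_card X(1) padic_cauchy_const[OF prime_card, of "- X N"]] by simp
  ultimately have "(\<lambda>n. padic_abs CARD('p) (X n - X N)) \<longlonglongrightarrow> padic_norm (x - abs_padic (\<lambda>_. X N))"
    using padic_norm_tendsto by simp
  then have "padic_norm (x - abs_padic (\<lambda>_. X N)) \<le> e"
    by (rule LIMSEQ_le_const2) (use N in \<open>auto intro!: exI[of _ N] less_imp_le\<close>)
  then show ?thesis by blast
qed

lemma padic_norm_diff_const_le:
  assumes X: "padic_cauchy CARD('p) X"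
    and le: "\<And>m. m \<ge> n \<Longrightarrow> padic_abs CARD('p) (X m - q) \<le> e"
  shows "padic_norm (abs_padic X - abs_padic (\<lambda>_. q) :: 'p::prime_card padic) \<le> e"
proof -
  have "padic_cauchy CARD('p) (\<lambda>n. X n - q)"
    using padic_cauchy_add[OF prime_card X padic_cauchy_const[OF prime_card, of "- q"]] by simp
  moreover have "abs_padic X - abs_padic (\<lambda>_. q) = (abs_padic (\<lambda>n. X n - q) :: 'p padic)"
    by (rule abs_padic_diff[OF X padic_cauchy_const[OF prime_card]])
  ultimately have "(\<lambda>n. padic_abs CARD('p) (X n - q)) \<longlonglongrightarrow>
      padic_norm (abs_padic X - abs_padic (\<lambda>_. q) :: 'p padic)"
    using padic_norm_tendsto by metis
  then show ?thesis
    by (rule LIMSEQ_le_const2) (use le in blast)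
qed

text \<open>The sum is exhibited directly: the rational partial sums form a Cauchy sequence
  \<open>X\<close>, and its class is the limit.\<close>

lemma padic_summable_digits:
  "summable (\<lambda>i. of_nat (a i) * of_nat CARD('p) ^ i :: 'p::prime_card padic)"
proof -
  let ?p = "CARD('p)"
  define X where "X n = (\<Sum>i<n. of_nat (a i) * of_nat ?p ^ i :: rat)" for n
  have term_le: "padic_abs ?p (of_nat (a i) * of_nat ?p ^ i) \<le> (1 / real ?p) ^ i" for i
  proof -
    have "padic_abs ?p (of_nat ?p) = 1 / real ?p"
      using padic_abs_of_int[OF prime_card[where 'a = 'p], of "int ?p"] prime_card[where 'a = 'p] by simp
    then have "padic_abs ?p (of_nat ?p ^ i) = (1 / real ?p) ^ i"
      by (induction i) (simp_all add: padic_abs_mult[OF prime_card] padic_abs_1[OF prime_card])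
    moreover have "padic_abs ?p (of_nat (a i)) \<le> 1"
      using padic_abs_of_int_le_1[OF prime_card[where 'a = 'p], of "int (a i)"] by simp
    ultimately show ?thesis
      by (simp add: padic_abs_mult[OF prime_card] mult_left_le_one_le padic_abs_nonneg[OF prime_card])
  qed
  have p1: "0 \<le> 1 / real ?p" "1 / real ?p < 1"
    using prime_gt_1_nat[OF prime_card[where 'a = 'p]] by simp_all
  have "padic_abs ?p (X (m + n) - X n) \<le> (1 / real ?p) ^ n" for m n
  proof (induction m)
    case 0
    then show ?case using p1 by (simp add: padic_abs_0[OF prime_card])
  next
    case (Suc m)
    have "padic_abs ?p (X (Suc m + n) - X n) =
        padic_abs ?p (of_nat (a (m + n)) * of_nat ?p ^ (m + n) + (X (m + n) - X n))"
      by (simp add: X_def algebra_simps)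
    also have "\<dots> \<le> max (padic_abs ?p (of_nat (a (m + n)) * of_nat ?p ^ (m + n))) (padic_abs ?p (X (m + n) - X n))"
      by (rule padic_abs_ultra[OF prime_card])
    also have "\<dots> \<le> (1 / real ?p) ^ n"
    proof -
      have "(1 / real ?p) ^ (m + n) \<le> (1 / real ?p) ^ n"
        using p1 by (intro power_decreasing) auto
      with Suc term_le[of "m + n"] show ?thesis by linarith
    qed
    finally show ?case .
  qed
  from this[of "_ - _"] have le: "padic_abs ?p (X m - X n) \<le> (1 / real ?p) ^ n" if "m \<ge> n" for m n
    using that by (metis le_add_diff_inverse2)
  have cauchy: "padic_cauchy ?p X"
    unfolding padic_cauchy_def
  proof (intro allI impI)
    fix e :: real assume "e > 0"
    then obtain k where k: "(1 / real ?p) ^ k < e"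
      using real_arch_pow_inv p1(2) by blast
    have "padic_abs ?p (X m - X n) < e" if "m \<ge> k" "n \<ge> k" for m n
    proof -
      \<comment> \<open>The bound \<open>le\<close> needs ordered indices, so both terms are
        compared with the earlier \<open>X k\<close>.\<close>
      have "padic_abs ?p (X m - X n) \<le> max (padic_abs ?p (X m - X k)) (padic_abs ?p (X k - X n))"
        using padic_abs_ultra[OF prime_card[where 'a = 'p], of "X m - X k" "X k - X n"] by simp
      also have "\<dots> \<le> (1 / real ?p) ^ k"
        using le[OF that(1)] le[OF that(2)] by (simp add: padic_abs_diff_commute[OF prime_card, of "X k"])
      finally show ?thesis using k by simp
    qed
    then show "\<exists>k. \<forall>m\<ge>k. \<forall>n\<ge>k. padic_abs ?p (X m - X n) < e" by blast
  qed
  \<comment> \<open>Each partial sum is a natural number and so is the class of a constant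
    sequence.\<close>
  have of_rat: "(\<Sum>i<n. of_nat (a i) * of_nat ?p ^ i :: 'p padic) = abs_padic (\<lambda>_. X n)" for n
  proof -
    have "(\<Sum>i<n. of_nat (a i) * of_nat ?p ^ i :: 'p padic) = of_nat (\<Sum>i<n. a i * ?p ^ i)"
      by simp
    also have "\<dots> = abs_padic (\<lambda>_. X n)"
      unfolding padic_of_nat X_def by simp
    finally show ?thesis .
  qed
  have "(\<lambda>i. of_nat (a i) * of_nat ?p ^ i) sums (abs_padic X :: 'p padic)"
    unfolding sums_def of_rat
  proof (rule metric_tendsto_imp_tendsto)
    show "(\<lambda>n. (1 / real ?p) ^ n) \<longlonglongrightarrow> 0"
      using p1 by (intro LIMSEQ_power_zero) simp
    have "dist (abs_padic (\<lambda>_. X n)) (abs_padic X :: 'p padic) \<le> (1 / real ?p) ^ n" for n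
      using padic_norm_diff_const_le[OF cauchy le[of n]] by (simp add: dist_commute dist_padic_def)
    then show "\<forall>\<^sub>F n in sequentially. dist (abs_padic (\<lambda>_. X n)) (abs_padic X :: 'p padic)
        \<le> dist ((1 / real ?p) ^ n) 0"
      by (simp add: always_eventually)
  qed
  then show ?thesis
    by (rule sums_summable)
qed

lemma padic_norm_of_nat: "padic_norm (of_nat n :: 'p::prime_card padic) = padic_abs CARD('p) (of_int (int n))"
  by (simp add: padic_of_nat padic_norm_const)

lemma padic_norm_diff_of_nat:
  "padic_norm (abs_padic (\<lambda>_. q) - of_nat n :: 'p::prime_card padic) = padic_abs CARD('p) (q - of_nat n)"
  unfolding padic_of_nat
  by (simp add: abs_padic_diff padic_norm_const padic_cauchy_const[OF prime_card])

lemma padic_digit_expansion: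
  "digit_expansion CARD('p) (of_nat CARD('p) :: 'p::prime_card padic) (1 / real CARD('p))"
proof
  let ?p = "CARD('p)"
  have p: "?p > 1"
    by (rule prime_gt_1_nat[OF prime_card])
  then show "2 \<le> ?p" "0 < 1 / real ?p" "1 / real ?p < 1"
    by simp_all
  fix x y z :: "'p padic"
  show "dist (x + z) (y + z) = dist x y"
    by (simp add: dist_padic_def)
  show "dist x z \<le> max (dist x y) (dist y z)"
    using padic_norm_ultra[of "x - y" "y - z"] by (simp add: dist_padic_def)
  have "padic_norm (of_nat ?p :: 'p padic) = 1 / real ?p"
    using padic_abs_of_int[OF prime_card[where 'a = 'p], of "int ?p"] prime_card[where 'a = 'p]
    by (simp add: padic_norm_of_nat)
  then show "dist (of_nat ?p * x) 0 = 1 / real ?p * dist x 0"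
    by (simp add: dist_padic_def padic_norm_mult)
  show "dist (of_nat n) (0 :: 'p padic) \<le> 1" for n
    using padic_abs_of_int_le_1[OF prime_card[where 'a = 'p], of "int n"]
    by (simp add: dist_padic_def padic_norm_of_nat)
  show "\<exists>d<?p. dist x (of_nat d) \<le> 1 / real ?p" if x: "dist x 0 \<le> 1"
  proof -
    \<comment> \<open>Approximating \<open>x\<close> by a rational \<open>q\<close> to within 1/p
      keeps the residue: \<open>q\<close> is again integral by the ultrametric inequality, and its
      residue serves for \<open>x\<close>.\<close>
    obtain q where q: "padic_norm (x - abs_padic (\<lambda>_. q)) \<le> 1 / real ?p"
      using padic_rat_approx[of "1 / real ?p" x] p by auto
    have "padic_abs ?p q = padic_norm (x + - (x - abs_padic (\<lambda>_. q)))"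
      by (simp add: padic_norm_const)
    also have "\<dots> \<le> max (padic_norm x) (padic_norm (x - abs_padic (\<lambda>_. q)))"
      using padic_norm_ultra padic_norm_minus by metis
    also have "\<dots> \<le> 1"
    proof -
      have "1 / real ?p \<le> 1"
        using p by simp
      with q have "padic_norm (x - abs_padic (\<lambda>_. q)) \<le> 1"
        by (rule order_trans)
      with x show ?thesis
        by (simp add: dist_padic_def)
    qed
    finally obtain d where d: "d < ?p" "padic_abs ?p (q - of_nat d) \<le> 1 / real ?p"
      using padic_abs_residue[OF prime_card] by blast
    have "padic_norm (x - of_nat d) \<le> max (padic_norm (x - abs_padic (\<lambda>_. q))) (padic_norm (abs_padic (\<lambda>_. q) - of_nat d :: 'p padic))"
      using padic_norm_ultra[of "x - abs_padic (\<lambda>_. q)" "abs_padic (\<lambda>_. q) - of_nat d"] by simp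
    also have "\<dots> \<le> 1 / real ?p"
      using q d by (simp add: padic_norm_diff_of_nat)
    finally show ?thesis
      using d by (auto simp: dist_padic_def)
  qed
  show "d = e" if "d < ?p" "e < ?p" "dist (of_nat d) (of_nat e :: 'p padic) \<le> 1 / real ?p" for d e
  proof -
    have "padic_abs ?p (of_int (int d - int e)) \<le> 1 / real ?p"
      using that(3) padic_norm_diff_of_nat[of "of_nat d" e, where 'p = 'p]
      by (simp add: dist_padic_def flip: padic_of_nat)
    then have "int ?p dvd int d - int e"
      by (simp only: padic_abs_of_int_le_inverse_iff[OF prime_card])
    then show ?thesis
      using that(1,2) by (metis mod_eq_dvd_iff mod_pos_pos_trivial nat_int of_nat_0_le_iff of_nat_less_iff)
  qed
qed (rule padic_summable_digits)

section \<open>Laurent series over the field with p elements\<close>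

lemma dist_fls_powi: "dist a b = (if a = b then 0 else (1 / 2) powi fls_subdegree (a - b))"
  for a b :: "'a::group_add fls"
  by (simp add: dist_fls_def power_int_def inverse_eq_divide power_one_over)

context
  includes fps_syntax
begin

text \<open>This translates metric statements into statements about coefficients, in which residues
  and convergence are easy to check.\<close>

lemma dist_fls_le_iff:
  fixes a b :: "'a::group_add fls"
  shows "dist a b \<le> (1 / 2) ^ n \<longleftrightarrow> (\<forall>k<int n. (a - b) $$ k = 0)"
proof (cases "a = b")
  case False
  have "dist a b \<le> (1 / 2) ^ n \<longleftrightarrow> (1 / 2 :: real) powi fls_subdegree (a - b) \<le> (1 / 2) powi int n"
    using False by (simp add: dist_fls_powi)
  also have "\<dots> \<longleftrightarrow> int n \<le> fls_subdegree (a - b)"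
    using power_int_strict_decreasing[of "fls_subdegree (a - b)" "int n" "1 / 2 :: real"]
      power_int_decreasing[of "int n" "fls_subdegree (a - b)" "1 / 2 :: real"]
    by (cases "int n \<le> fls_subdegree (a - b)") auto
  also have "\<dots> \<longleftrightarrow> (\<forall>k<int n. (a - b) $$ k = 0)"
    using False fls_eq0_below_subdegree[of _ "a - b"] fls_subdegree_geI[of "a - b" "int n"] by force
  finally show ?thesis .
qed simp

lemma mod_ring_ex_of_nat: "\<exists>d<CARD('p). of_nat d = (x :: 'p::prime_card mod_ring)"
proof -
  have "to_int_mod_ring x \<in> {0..<int CARD('p)}"
    using range_to_int_mod_ring[where 'a = 'p] by blast
  then have "nat (to_int_mod_ring x) < CARD('p)" "of_nat (nat (to_int_mod_ring x)) = x"
    by (auto simp: of_nat_of_int_mod_ring nat_less_iff)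
  then show ?thesis by blast
qed

lemma mod_ring_of_nat_inj:
  assumes "d < CARD('p)" "e < CARD('p)" "of_nat d = (of_nat e :: 'p::prime_card mod_ring)"
  shows "d = e"
  using arg_cong[OF assms(3), of to_int_mod_ring] assms(1,2) by (simp add: of_nat_of_int_mod_ring)

lemma fls_digit_expansion:
  "digit_expansion CARD('p) (fls_X :: 'p::prime_card mod_ring fls) (1 / 2)"
proof
  let ?p = "CARD('p)"
  show "2 \<le> ?p"
    by (rule prime_ge_2_nat[OF prime_card])
  fix x y z :: "'p mod_ring fls"
  show "dist (x + z) (y + z) = dist x y"
    by (simp add: dist_fls_powi)
  show "dist x z \<le> max (dist x y) (dist y z)"
  proof (cases "x = y \<or> y = z \<or> x = z")
    case False
    then have "min (fls_subdegree (x - y)) (fls_subdegree (y - z)) \<le> fls_subdegree (x - z)"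
      using fls_plus_subdegree[of "x - y" "y - z"] by simp
    then have "(1 / 2 :: real) powi fls_subdegree (x - z) \<le> (1 / 2) powi (min (fls_subdegree (x - y)) (fls_subdegree (y - z)))"
      by (intro power_int_decreasing) auto
    with False show ?thesis
      by (auto simp: dist_fls_powi min_def le_max_iff_disj split: if_splits)
  qed (auto simp: le_max_iff_disj)
  show "dist (fls_X * x) 0 = 1 / 2 * dist x 0"
    by (simp add: dist_fls_powi fls_subdegree_mult_fls_X power_int_add)
  show "dist (of_nat n) (0 :: 'p mod_ring fls) \<le> 1" for n
    using dist_fls_le_iff[of "of_nat n :: 'p mod_ring fls" 0 0] by (simp add: fls_of_nat_nth)
  show "\<exists>d<?p. dist x (of_nat d) \<le> 1 / 2" if "dist x 0 \<le> 1"
  proof -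
    \<comment> \<open>The residue of an integral series is its constant coefficient.\<close>
    obtain d where d: "d < ?p" "of_nat d = x $$ 0"
      using mod_ring_ex_of_nat by blast
    have "x $$ k = 0" if "k < 0" for k
      using \<open>dist x 0 \<le> 1\<close> that dist_fls_le_iff[of x 0 0] by simp
    then have "(x - of_nat d) $$ k = 0" if "k < 1" for k
      using that d by (cases "k = 0") (auto simp: fls_of_nat_nth)
    then have "dist x (of_nat d) \<le> 1 / 2"
      using dist_fls_le_iff[of x "of_nat d" 1] by simp
    with d show ?thesis by blast
  qed
  show "d = e" if "d < ?p" "e < ?p" "dist (of_nat d) (of_nat e :: 'p mod_ring fls) \<le> 1 / 2" for d e
  proof -
    have "(of_nat d - of_nat e :: 'p mod_ring fls) $$ 0 = 0"
      using that(3) dist_fls_le_iff[of "of_nat d :: 'p mod_ring fls" "of_nat e" 1] by simp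
    then have "of_nat d = (of_nat e :: 'p mod_ring)"
      by (simp add: fls_of_nat_nth)
    with that show ?thesis
      by (intro mod_ring_of_nat_inj)
  qed
  show "summable (\<lambda>i. of_nat (a i) * fls_X ^ i :: 'p mod_ring fls)" for a
  proof -
    \<comment> \<open>The limit is the power series with the digits as coefficients; the partial sum
      of length \<open>n\<close> agrees with it below degree \<open>n\<close>.\<close>
    let ?s = "fps_to_fls (Abs_fps (\<lambda>i. of_nat (a i))) :: 'p mod_ring fls"
    have coeff: "(\<Sum>i<n. of_nat (a i) * fls_X ^ i :: 'p mod_ring fls) $$ k =
        (if 0 \<le> k \<and> k < int n then of_nat (a (nat k)) else 0)" for n k
      by (induction n) auto
    have "(\<lambda>i. of_nat (a i) * fls_X ^ i) sums ?s"
      unfolding sums_def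
    proof (rule metric_tendsto_imp_tendsto)
      show "(\<lambda>n. (1 / 2 :: real) ^ n) \<longlonglongrightarrow> 0"
        by (intro LIMSEQ_power_zero) simp
      have "dist (\<Sum>i<n. of_nat (a i) * fls_X ^ i) ?s \<le> (1 / 2) ^ n" for n
        unfolding dist_fls_le_iff by (simp add: coeff)
      then show "\<forall>\<^sub>F n in sequentially. dist (\<Sum>i<n. of_nat (a i) * fls_X ^ i) ?s \<le> dist ((1 / 2 :: real) ^ n) 0"
        by (simp add: always_eventually)
    qed
    then show ?thesis
      by (rule sums_summable)
  qed
qed auto

end

theorem theorem3:
  fixes \<rho> :: ennreal
  assumes "1 \<le> \<rho>"
  shows
    "(\<forall>\<mu> :: 'p::prime_card padic measure. normalized_haar_measure \<mu> \<longrightarrow>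
        (let M = restrict_space \<mu> \<O>; N = lebesgue_on {0..1};
             \<phi> = varrho CARD('p) (of_nat CARD('p))
         in pullback_well_defined \<rho> M N \<phi> \<and>
            linear_surjective_isometry \<rho> M N (pullback N \<phi>))) \<and>
     (\<forall>\<mu> :: 'p mod_ring fls measure. normalized_haar_measure \<mu> \<longrightarrow>
        (let M = restrict_space \<mu> \<O>; N = lebesgue_on {0..1};
             \<phi> = varrho CARD('p) fls_X
         in pullback_well_defined \<rho> M N \<phi> \<and>
            linear_surjective_isometry \<rho> M N (pullback N \<phi>)))"
  \<comment> \<open>The two conjuncts instantiate the common result with uniformizers of absolute
    value 1/p and 1/2 respectively.\<close>
  unfolding Let_def
  using digit_expansion.varrho_pullback_isometry[OF padic_digit_expansion]
    digit_expansion.varrho_pullback_isometry[OF fls_digit_expansion]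
  by blast

end
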